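(* Let $k$ be an algebraically closed field of characteristic zero, let $n>1$ and $m>1$ be integers, let $\mathbf{x}=(x_1,\dots,x_n)$ be variables, and let $$P(\mathbf{x},z)=z^{m}+w_{1}(\mathbf{x})z^{m-1}+\cdots+w_{m-1}(\mathbf{x})z+w_{m}(\mathbf{x}),\qquad w_i(\mathbf{x})\in k[[\mathbf{x}]],\quad w_m(\mathbf{x})\neq 0,$$ be a polynomial having only simple roots in any algebraic closure of $k((\mathbf{x}))$. Then the roots of $P(\mathbf{x},z)=0$ are formal power series with rational exponents of bounded denominators whose Newton diagrams are contained in an $S$-cone; that is, there exist an integer $d>0$, an $S$-cone $\Gamma\subset\mathbb{R}^n$ and elements $\zeta_1,\dots,\zeta_m\in K_{n,d}$ such that $P(\mathbf{x},z)=\prod_{i=1}^m (z-\zeta_i)$ and $\mathcal{E}(\zeta_i)\subset\Gamma$ for all $i=1,\dots,m$.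
   Context: $k((\mathbf{x}))$ is the quotient field of $k[[\mathbf{x}]]$. Series. For an integer $d>0$, $\mathcal{F}_{n,d}$ is the set of all functions $f:\frac1d\mathbb{Z}^n\to k$, written as formal sums $f=\sum_{\mathbf{a}\in\mathbb{Z}^n}f_{\mathbf{a}}\mathbf{x}^{\mathbf{a}/d}$ with $f_{\mathbf{a}}=f(\mathbf{a}/d)$, $\mathbf{x}^{\mathbf{a}/d}=x_1^{a_1/d}\cdots x_n^{a_n/d}$. The Newton diagram of $f$ is $\mathcal{E}(f)=\{\mathbf{a}/d : \mathbf{a}\in\mathbb{Z}^n,\ f_{\mathbf{a}}\neq 0\}$. $K_{n,d}=k((x_n^{1/d}))\cdots((x_1^{1/d}))$ is the field of iterated formal Laurent series ($K_{1,d}=k((x_1^{1/d}))$, and for $n>1$, $K_{n,d}=L((x_1^{1/d}))$ with $L=k((x_n^{1/d}))\cdots((x_2^{1/d}))$), regarded as a subset of $\mathcal{F}_{n,d}$ by sending a series to its function of coefficients. It contains $k[[\mathbf{x}]]$. Cones. A polyhedral cone in $\mathbb{R}^n$ is a set $\Gamma(\Delta)=\bigcup_{\mathbf{a}\in\Delta}\{\lambda\mathbf{a}:\lambda\ge 0\}$, where $\Delta$ is a compact polyhedron contained in an affine hyperplane $H$ with $\mathbf{0}\notin H$, and $\Delta$ has non-empty interior in $H$. For $i\neq j$, the monomial blowing-up $\varphi_{ij}$ is the linear automorphism of $\mathbb{R}^n$ which replaces the $j$-th coordinate $a_j$ of $(a_1,\dots,a_n)$ by $a_i+a_j$ and leaves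 the other coordinates unchanged; it is order-preserving (for the lexicographic order) if and only if $i<j$. An $S$-cone is a polyhedral cone $\Gamma$ that can be brought to the first quadrant by a finite sequence of order-preserving monomial blowing-ups, i.e. $\Phi(\Gamma)\subset\mathbb{R}_{\ge0}^n$ for some finite composition $\Phi$ of maps $\varphi_{ij}$ with $i<j$. *)

theory Defs
  imports "HOL-Analysis.Analysis" "HOL-Algebra.Algebraic_Closure_Type"
begin

no_notation fps_nth (infixl "$" 75)

text \<open>
  The variables \<open>x_1, ..., x_n\<close> are indexed by a finite linearly ordered type \<open>'n\<close>; the order of
  \<open>'n\<close> is the order of the variables. Exponents are vectors indexed by \<open>'n\<close>.
\<close>

section \<open>Iterated Laurent series\<close>

text \<open>
  For a list \<open>[i_1, ..., i_r]\<close> of variables, the set below is the iterated Laurent series field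
  \<open>k((t_{i_r}))...((t_{i_1}))\<close>, as a set of coefficient functions; exponents of variables that are
  not in the list are zero. In the recursive clause \<open>c j\<close> is the coefficient of \<open>t_i ^ j\<close>.
\<close>

fun iter_laurent :: "'n::finite list \<Rightarrow> (int ^ 'n \<Rightarrow> 'a::zero) set" where
  "iter_laurent [] = {f. \<forall>a. a \<noteq> 0 \<longrightarrow> f a = 0}"
| "iter_laurent (i # is) =
     {f. \<exists>c N. (\<forall>j::int. c j \<in> iter_laurent is) \<and> (\<forall>j<N. c j = (\<lambda>_. 0)) \<and>
          f = (\<lambda>a. c (a $ i) (\<chi> l. if l = i then 0 else a $ l))}"

text \<open>
  The supports of iterated Laurent series, see \<open>iter_laurent_iff\<close> below.
\<close>

fun wb :: "'n::finite list \<Rightarrow> (int ^ 'n) set \<Rightarrow> bool" where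
  "wb [] A = True"
| "wb (i # is) A = ((\<exists>N. \<forall>a\<in>A. N \<le> a $ i) \<and> (\<forall>c. wb is {a \<in> A. a $ i = c}))"

lemma wb_mono: "wb is A \<Longrightarrow> B \<subseteq> A \<Longrightarrow> wb is B"
proof (induction "is" arbitrary: A B)
  case (Cons i "is")
  have "wb is {a \<in> B. a $ i = c}" for c
    using Cons.IH[of "{a \<in> A. a $ i = c}" "{a \<in> B. a $ i = c}"] Cons.prems by auto
  then show ?case using Cons.prems by (simp, blast)
qed simp

lemma wb_empty [simp]: "wb is {}"
  by (induction "is") auto

lemma wb_singleton: "wb is {x}"
proof (induction "is")
  case (Cons i "is")
  then show ?case by (auto intro: wb_mono)
qed simp

lemma wb_Un: "wb is A \<Longrightarrow> wb is B \<Longrightarrow> wb is (A \<union> B)"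
proof (induction "is" arbitrary: A B)
  case (Cons i "is")
  obtain M N where M: "\<forall>a\<in>A. M \<le> a $ i" and N: "\<forall>a\<in>B. N \<le> a $ i"
    using Cons.prems by auto
  have "\<forall>a\<in>A \<union> B. min M N \<le> a $ i" using M N by (auto simp: min_le_iff_disj)
  moreover have "wb is {a \<in> A \<union> B. a $ i = c}" for c
  proof -
    have "{a \<in> A \<union> B. a $ i = c} = {a \<in> A. a $ i = c} \<union> {a \<in> B. a $ i = c}" by auto
    then show ?thesis using Cons by simp
  qed
  ultimately show ?case by (simp only: wb.simps) blast
qed simp

lemma wb_supp_op:
  "wb is {a. f a \<noteq> 0} \<Longrightarrow> wb is {a. g a \<noteq> 0} \<Longrightarrow> (\<And>a. f a = 0 \<Longrightarrow> g a = 0 \<Longrightarrow> h a = 0)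
    \<Longrightarrow> wb is {a. h a \<noteq> 0}"
  by (rule wb_mono[of _ "{a. f a \<noteq> 0} \<union> {a. g a \<noteq> 0}"]) (auto intro: wb_Un)

lemma wb_UN: "finite I \<Longrightarrow> (\<And>x. x \<in> I \<Longrightarrow> wb is (A x)) \<Longrightarrow> wb is (\<Union>x\<in>I. A x)"
  by (induction I rule: finite_induct) (auto intro: wb_Un)

lemma wb_plus:
  "wb is A \<Longrightarrow> wb is B \<Longrightarrow> wb is {a + b | a b. a \<in> A \<and> b \<in> B}"
proof (induction "is" arbitrary: A B)
  case (Cons i "is")
  obtain M N where M: "\<forall>a\<in>A. M \<le> a $ i" and N: "\<forall>a\<in>B. N \<le> a $ i"
    using Cons.prems by auto
  let ?S = "{a + b | a b. a \<in> A \<and> b \<in> B}"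
  have "\<forall>s\<in>?S. M + N \<le> s $ i" using M N by (fastforce intro: add_mono)
  moreover have "wb is {a \<in> ?S. a $ i = c}" for c
  proof -
    let ?A = "\<lambda>u. {a \<in> A. a $ i = u}" and ?B = "\<lambda>u. {a \<in> B. a $ i = u}"
    have "{s \<in> ?S. s $ i = c} \<subseteq> (\<Union>u\<in>{M..c - N}. {a + b | a b. a \<in> ?A u \<and> b \<in> ?B (c - u)})"
    proof
      fix s assume "s \<in> {s \<in> ?S. s $ i = c}"
      then obtain a b where ab: "a \<in> A" "b \<in> B" "s = a + b" "a $ i + b $ i = c" by auto
      then have "a $ i \<in> {M..c - N}" "a \<in> ?A (a $ i)" "b \<in> ?B (c - a $ i)"
        using M N by (auto simp: algebra_simps)
      then show "s \<in> (\<Union>u\<in>{M..c - N}. {a + b | a b. a \<in> ?A u \<and> b \<in> ?B (c - u)})"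
        using ab by blast
    qed
    moreover have "wb is (\<Union>u\<in>{M..c - N}. {a + b | a b. a \<in> ?A u \<and> b \<in> ?B (c - u)})"
    proof (rule wb_UN)
      fix u
      have "wb is (?A u)" "wb is (?B (c - u))" using Cons.prems by simp_all
      then show "wb is {a + b | a b. a \<in> ?A u \<and> b \<in> ?B (c - u)}" by (rule Cons.IH)
    qed simp
    ultimately show ?thesis using wb_mono by blast
  qed
  ultimately show ?case by (simp only: wb.simps) blast
qed simp

lemma wb_finite:
  assumes "wb is A" "wb is B"
    and "\<And>a b l. a \<in> A \<Longrightarrow> b \<in> A \<Longrightarrow> l \<notin> set is \<Longrightarrow> a $ l = b $ l"
    and "\<And>a b l. a \<in> B \<Longrightarrow> b \<in> B \<Longrightarrow> l \<notin> set is \<Longrightarrow> a $ l = b $ l"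
  shows "finite {a \<in> A. c - a \<in> B}"
  using assms
proof (induction "is" arbitrary: A B)
  case Nil
  have "a = b" if "a \<in> A" "b \<in> A" for a b
    using Nil.prems(3)[OF that] by (simp add: vec_eq_iff)
  then have "A \<subseteq> {a}" if "a \<in> A" for a using that by blast
  then have "finite A" by (metis all_not_in_conv finite.emptyI finite.insertI finite_subset)
  then show ?case by simp
next
  case (Cons i "is")
  obtain M N where M: "\<forall>a\<in>A. M \<le> a $ i" and N: "\<forall>a\<in>B. N \<le> a $ i"
    using Cons.prems by auto
  let ?A = "\<lambda>u. {a \<in> A. a $ i = u}" and ?B = "\<lambda>u. {a \<in> B. a $ i = u}"
  have "{a \<in> A. c - a \<in> B} \<subseteq> (\<Union>u\<in>{M..c $ i - N}. {a \<in> ?A u. c - a \<in> ?B (c $ i - u)})"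
  proof
    fix a assume a: "a \<in> {a \<in> A. c - a \<in> B}"
    then have "M \<le> a $ i" "N \<le> (c - a) $ i" using M N by blast+
    then have "a $ i \<in> {M..c $ i - N}" by simp
    moreover have "a \<in> {b \<in> ?A (a $ i). c - b \<in> ?B (c $ i - a $ i)}" using a by simp
    ultimately show "a \<in> (\<Union>u\<in>{M..c $ i - N}. {a \<in> ?A u. c - a \<in> ?B (c $ i - u)})" by blast
  qed
  moreover have "finite {a \<in> ?A u. c - a \<in> ?B (c $ i - u)}" for u
  proof (rule Cons.IH)
    show "wb is (?A u)" "wb is (?B (c $ i - u))" using Cons.prems(1,2) by simp_all
    show "a $ l = b $ l" if "a \<in> ?A u" "b \<in> ?A u" "l \<notin> set is" for a b l
      using that Cons.prems(3)[of a b l] by (cases "l = i") auto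
    show "a $ l = b $ l" if "a \<in> ?B (c $ i - u)" "b \<in> ?B (c $ i - u)" "l \<notin> set is" for a b l
      using that Cons.prems(4)[of a b l] by (cases "l = i") auto
  qed
  then have "finite (\<Union>u\<in>{M..c $ i - N}. {a \<in> ?A u. c - a \<in> ?B (c $ i - u)})"
    by (intro finite_UN_I) simp_all
  ultimately show ?case by (rule finite_subset)
qed

lemma wb_min:
  assumes "wb is A" "wb is B" "A \<noteq> {}" "B \<noteq> {}"
    and "\<And>a b l. a \<in> A \<Longrightarrow> b \<in> A \<Longrightarrow> l \<notin> set is \<Longrightarrow> a $ l = b $ l"
    and "\<And>a b l. a \<in> B \<Longrightarrow> b \<in> B \<Longrightarrow> l \<notin> set is \<Longrightarrow> a $ l = b $ l"
  shows "\<exists>m\<in>A. \<exists>p\<in>B. \<forall>a\<in>A. \<forall>b\<in>B. a + b = m + p \<longrightarrow> a = m"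
  using assms
proof (induction "is" arbitrary: A B)
  case Nil
  have "a = b" if "a \<in> A" "b \<in> A" for a b
    using Nil.prems(5)[OF that] by (simp add: vec_eq_iff)
  then show ?case using Nil.prems(3,4) by blast
next
  case (Cons i "is")
  have ex: "\<exists>x\<in>S. \<forall>a\<in>S. x $ i \<le> a $ i" if S: "S \<noteq> {}" and N: "\<forall>a\<in>S. N \<le> a $ i"
    for S :: "(int ^ 'a) set" and N
  proof -
    obtain y where "y \<in> S" using S by blast
    then obtain x where x: "x \<in> S" "\<And>a. a \<in> S \<Longrightarrow> nat (x $ i - N) \<le> nat (a $ i - N)"
      using ex_has_least_nat[of "\<lambda>a. a \<in> S" y "\<lambda>a. nat (a $ i - N)"] by blast
    have "x $ i \<le> a $ i" if "a \<in> S" for a using x(2)[OF that] N that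
      by (auto simp: nat_le_eq_zle)
    then show ?thesis using x(1) by blast
  qed
  obtain M N where M: "\<forall>a\<in>A. M \<le> a $ i" and N: "\<forall>a\<in>B. N \<le> a $ i"
    using Cons.prems(1,2) by auto
  obtain x where x: "x \<in> A" "\<forall>a\<in>A. x $ i \<le> a $ i" using ex[OF Cons.prems(3) M] by blast
  obtain y where y: "y \<in> B" "\<forall>a\<in>B. y $ i \<le> a $ i" using ex[OF Cons.prems(4) N] by blast
  let ?A = "{a \<in> A. a $ i = x $ i}" and ?B = "{a \<in> B. a $ i = y $ i}"
  have "\<exists>m\<in>?A. \<exists>p\<in>?B. \<forall>a\<in>?A. \<forall>b\<in>?B. a + b = m + p \<longrightarrow> a = m"
  proof (rule Cons.IH)
    show "wb is ?A" "wb is ?B" using Cons.prems(1,2) by simp_all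
    show "?A \<noteq> {}" "?B \<noteq> {}" using x y by auto
    show "a $ l = b $ l" if "a \<in> ?A" "b \<in> ?A" "l \<notin> set is" for a b l
      using that Cons.prems(5)[of a b l] by (cases "l = i") auto
    show "a $ l = b $ l" if "a \<in> ?B" "b \<in> ?B" "l \<notin> set is" for a b l
      using that Cons.prems(6)[of a b l] by (cases "l = i") auto
  qed
  then obtain m p where mp: "m \<in> ?A" "p \<in> ?B"
    "\<And>a b. a \<in> ?A \<Longrightarrow> b \<in> ?B \<Longrightarrow> a + b = m + p \<Longrightarrow> a = m" by blast
  have "a = m" if "a \<in> A" "b \<in> B" "a + b = m + p" for a b
  proof (rule mp(3)[OF _ _ that(3)])
    have "a $ i + b $ i = m $ i + p $ i" using that(3) by (metis vector_add_component)
    moreover have "x $ i \<le> a $ i" "y $ i \<le> b $ i" using x y that by auto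
    ultimately have "a $ i = x $ i" "b $ i = y $ i" using mp(1,2) by auto
    then show "a \<in> ?A" "b \<in> ?B" using that by auto
  qed
  then show ?case using mp(1,2) by blast
qed

lemma wb_image:
  assumes "wb is A" "\<And>a l. a \<in> A \<Longrightarrow> l \<in> set is \<Longrightarrow> g a $ l = a $ l"
  shows "wb is (g ` A)"
  using assms
proof (induction "is" arbitrary: A)
  case (Cons i "is")
  have "{a \<in> g ` A. a $ i = c} = g ` {a \<in> A. a $ i = c}" for c
    using Cons.prems(2) by auto
  moreover have "wb is (g ` {a \<in> A. a $ i = c})" for c
    using Cons by auto
  moreover obtain N where "\<forall>a\<in>A. N \<le> a $ i" using Cons.prems(1) by auto
  then have "\<forall>a\<in>g ` A. N \<le> a $ i" using Cons.prems(2) by auto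
  ultimately show ?case by auto
qed simp

lemma iter_laurent_iff:
  fixes f :: "int ^ 'n::finite \<Rightarrow> 'a::zero"
  assumes "distinct is"
  shows "f \<in> iter_laurent is \<longleftrightarrow>
    (\<forall>a l. f a \<noteq> 0 \<longrightarrow> l \<notin> set is \<longrightarrow> a $ l = 0) \<and> wb is {a. f a \<noteq> 0}"
  using assms
proof (induction "is" arbitrary: f)
  case Nil
  then show ?case by (auto simp: vec_eq_iff)
next
  case (Cons i "is")
  let ?z = "\<lambda>a::int^'n. (\<chi> l. if l = i then 0 else a $ l) :: int^'n"
  let ?s = "\<lambda>(j::int) (a::int^'n). (\<chi> l. if l = i then j else a $ l) :: int^'n"
  show ?case (is "_ \<longleftrightarrow> ?R")
  proof
    assume "f \<in> iter_laurent (i # is)"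
    then obtain c N where c: "\<And>j::int. c j \<in> iter_laurent is" "\<And>j. j < N \<Longrightarrow> c j = (\<lambda>_. 0)"
      and f: "f = (\<lambda>a. c (a $ i) (?z a))" by auto
    have c': "\<And>j a l. c j a \<noteq> 0 \<Longrightarrow> l \<notin> set is \<Longrightarrow> a $ l = 0" "\<And>j. wb is {a. c j a \<noteq> 0}"
      using c(1) Cons by auto
    have "a $ l = 0" if "f a \<noteq> 0" "l \<notin> set (i # is)" for a l
      using c'(1)[of "a $ i" "?z a" l] that f by simp
    moreover have "\<forall>a\<in>{a. f a \<noteq> 0}. N \<le> a $ i"
    proof
      fix a assume "a \<in> {a. f a \<noteq> 0}"
      then have "c (a $ i) (?z a) \<noteq> 0" using f by simp
      then have "c (a $ i) \<noteq> (\<lambda>_. 0)" by metis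
      then show "N \<le> a $ i" using c(2)[of "a $ i"] by linarith
    qed
    moreover have "wb is {a \<in> {a. f a \<noteq> 0}. a $ i = j}" for j
    proof -
      have "{a \<in> {a. f a \<noteq> 0}. a $ i = j} \<subseteq> ?s j ` {a. c j a \<noteq> 0}"
      proof
        fix a assume a: "a \<in> {a \<in> {a. f a \<noteq> 0}. a $ i = j}"
        then have "?z a \<in> {a. c j a \<noteq> 0}" using f by auto
        moreover have "a = ?s j (?z a)" using a by (auto simp: vec_eq_iff)
        ultimately show "a \<in> ?s j ` {a. c j a \<noteq> 0}" by blast
      qed
      moreover have "wb is (?s j ` {a. c j a \<noteq> 0})"
        using Cons.prems by (intro wb_image c') auto
      ultimately show ?thesis using wb_mono by blast
    qed
    ultimately show ?R by (simp only: wb.simps) blast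
  next
    assume R: ?R
    then obtain N where N: "\<And>a. f a \<noteq> 0 \<Longrightarrow> N \<le> a $ i" by auto
    define c where "c = (\<lambda>(j::int) (a::int^'n). if a $ i = 0 then f (?s j a) else 0)"
    have "c j \<in> iter_laurent is" for j
    proof -
      have "a $ l = 0" if "c j a \<noteq> 0" "l \<notin> set is" for a l
      proof -
        have "l \<noteq> i \<Longrightarrow> ?s j a $ l = 0" using R that unfolding c_def by (metis insert_iff list.simps(15))
        then show ?thesis using that by (cases "l = i") (auto simp: c_def split: if_splits)
      qed
      moreover have "wb is {a. c j a \<noteq> 0}"
      proof -
        have "{a. c j a \<noteq> 0} \<subseteq> ?z ` {a \<in> {a. f a \<noteq> 0}. a $ i = j}"
        proof
          fix a assume "a \<in> {a. c j a \<noteq> 0}"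
          then have "a $ i = 0" "f (?s j a) \<noteq> 0" by (auto simp: c_def split: if_splits)
          then have "a = ?z (?s j a)" "?s j a \<in> {a \<in> {a. f a \<noteq> 0}. a $ i = j}"
            by (auto simp: vec_eq_iff)
          then show "a \<in> ?z ` {a \<in> {a. f a \<noteq> 0}. a $ i = j}" by blast
        qed
        moreover have "wb is (?z ` {a \<in> {a. f a \<noteq> 0}. a $ i = j})"
          using Cons.prems R by (intro wb_image) auto
        ultimately show ?thesis using wb_mono by blast
      qed
      ultimately show ?thesis using Cons by auto
    qed
    moreover have "c j = (\<lambda>_. 0)" if "j < N" for j
      using N that by (fastforce simp: c_def fun_eq_iff)
    moreover have "f = (\<lambda>a. c (a $ i) (?z a))"
    proof
      fix a
      have "?s (a $ i) (?z a) = a" by (auto simp: vec_eq_iff)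
      then show "f a = c (a $ i) (?z a)" by (simp add: c_def)
    qed
    ultimately show "f \<in> iter_laurent (i # is)" unfolding iter_laurent.simps by blast
  qed
qed

abbreviation vars :: "'n::{finite, linorder} list" where
  "vars \<equiv> sorted_list_of_set UNIV"

lemma iter_laurent_vars_iff: "f \<in> iter_laurent vars \<longleftrightarrow> wb vars {a. f a \<noteq> 0}"
  by (subst iter_laurent_iff) auto

text \<open>
  \<open>K_{n,d}\<close> is the iterated Laurent series field in \<open>t_i = x_i^(1/d)\<close>. Its elements are given by
  their coefficient functions \<open>a \<mapsto> f_a\<close>, where \<open>f_a\<close> belongs to the monomial
  \<open>t^a = x^(a/d)\<close>, so that the underlying ring is the same for all \<open>d\<close>. The denominator \<open>d\<close> enters
  where exponents in the \<open>x_i\<close> are meant: in the inclusion of \<open>k[[x]]\<close> and in the Newton diagram.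
\<close>

typedef (overloaded) ('a::zero, 'n::"{finite, linorder}") ilaurent =
  "iter_laurent vars :: ((int, 'n) vec \<Rightarrow> 'a) set"
  morphisms ilaurent_coeff Abs_ilaurent
  by (rule exI[of _ "\<lambda>_. 0"]) (simp add: iter_laurent_vars_iff)

setup_lifting type_definition_ilaurent

lemma ilaurent_eqI: "(\<And>a. ilaurent_coeff f a = ilaurent_coeff g a) \<Longrightarrow> f = g"
  by transfer auto

lemma wb_supp: "wb vars {a. ilaurent_coeff f a \<noteq> 0}"
  using ilaurent_coeff[of f] by (simp add: iter_laurent_vars_iff)

lemma finite_supp: "finite {a. ilaurent_coeff f a \<noteq> 0 \<and> ilaurent_coeff g (c - a) \<noteq> 0}"
  using wb_finite[OF wb_supp[of f] wb_supp[of g], of c] by simp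

definition conv :: "(int ^ 'n::finite \<Rightarrow> 'a::comm_ring_1) \<Rightarrow> (int ^ 'n \<Rightarrow> 'a) \<Rightarrow> int ^ 'n \<Rightarrow> 'a" where
  "conv f g c = (\<Sum>a | f a \<noteq> 0 \<and> g (c - a) \<noteq> 0. f a * g (c - a))"

lemma conv_nonzeroE:
  assumes "conv f g c \<noteq> 0"
  obtains a where "f a \<noteq> 0" "g (c - a) \<noteq> 0"
proof -
  obtain a where "a \<in> {a. f a \<noteq> 0 \<and> g (c - a) \<noteq> 0}"
    by (rule sum.not_neutral_contains_not_neutral[OF assms[unfolded conv_def]])
  then show ?thesis using that by blast
qed

instantiation ilaurent :: (comm_ring_1, "{finite, linorder}") comm_ring_1
begin

lift_definition zero_ilaurent :: "('a, 'b) ilaurent" is "\<lambda>_. 0"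
  by (simp add: iter_laurent_vars_iff)

lift_definition one_ilaurent :: "('a, 'b) ilaurent" is "\<lambda>a. if a = 0 then 1 else 0"
proof -
  have "wb vars {a::(int, 'b) vec. (if a = 0 then 1 else 0 :: 'a) \<noteq> 0}"
    by (rule wb_mono[OF wb_singleton[of _ 0]]) auto
  then show "(\<lambda>a. if a = 0 then 1 else 0) \<in> (iter_laurent vars :: ((int, 'b) vec \<Rightarrow> 'a) set)"
    by (simp only: iter_laurent_vars_iff)
qed

lift_definition plus_ilaurent :: "('a, 'b) ilaurent \<Rightarrow> ('a, 'b) ilaurent \<Rightarrow> ('a, 'b) ilaurent"
  is "\<lambda>f g a. f a + g a"
  unfolding iter_laurent_vars_iff by (erule (1) wb_supp_op) simp

lift_definition uminus_ilaurent :: "('a, 'b) ilaurent \<Rightarrow> ('a, 'b) ilaurent"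
  is "\<lambda>f a. - f a"
  unfolding iter_laurent_vars_iff by simp

lift_definition minus_ilaurent :: "('a, 'b) ilaurent \<Rightarrow> ('a, 'b) ilaurent \<Rightarrow> ('a, 'b) ilaurent"
  is "\<lambda>f g a. f a - g a"
  unfolding iter_laurent_vars_iff by (erule (1) wb_supp_op) simp

lift_definition times_ilaurent :: "('a, 'b) ilaurent \<Rightarrow> ('a, 'b) ilaurent \<Rightarrow> ('a, 'b) ilaurent"
  is conv
proof -
  fix f g :: "(int, 'b) vec \<Rightarrow> 'a"
  assume "f \<in> iter_laurent vars" "g \<in> iter_laurent vars"
  then have "wb vars {a + b | a b. a \<in> {a. f a \<noteq> 0} \<and> b \<in> {a. g a \<noteq> 0}}"
    unfolding iter_laurent_vars_iff by (rule wb_plus)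
  moreover have "{a. conv f g a \<noteq> 0} \<subseteq> {a + b | a b. a \<in> {a. f a \<noteq> 0} \<and> b \<in> {a. g a \<noteq> 0}}"
  proof
    fix c assume "c \<in> {a. conv f g a \<noteq> 0}"
    then obtain a where "f a \<noteq> 0" "g (c - a) \<noteq> 0" by (auto elim: conv_nonzeroE)
    then have "c = a + (c - a)" "a \<in> {a. f a \<noteq> 0}" "c - a \<in> {a. g a \<noteq> 0}" by auto
    then show "c \<in> {a + b | a b. a \<in> {a. f a \<noteq> 0} \<and> b \<in> {a. g a \<noteq> 0}}" by blast
  qed
  ultimately show "conv f g \<in> iter_laurent vars"
    unfolding iter_laurent_vars_iff using wb_mono by blast
qed

lemma ilaurent_coeff_times_superset:
  assumes "finite S" "{a. ilaurent_coeff f a \<noteq> 0 \<and> ilaurent_coeff g (c - a) \<noteq> 0} \<subseteq> S"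
  shows "ilaurent_coeff (f * g) c = (\<Sum>a\<in>S. ilaurent_coeff f a * ilaurent_coeff g (c - a))"
  unfolding times_ilaurent.rep_eq conv_def using assms
  by (intro sum.mono_neutral_left) auto

instance
proof
  fix f g h :: "('a, 'b) ilaurent"
  show "f + g + h = f + (g + h)" "f + g = g + f" "0 + f = f" "- f + f = 0" "f - g = f + - g"
    by (transfer; simp add: algebra_simps)+
  show "(0 :: ('a, 'b) ilaurent) \<noteq> 1"
    by transfer (metis zero_neq_one)
  show comm: "f * g = g * f" for f g :: "('a, 'b) ilaurent"
  proof (rule ilaurent_eqI)
    fix c
    show "ilaurent_coeff (f * g) c = ilaurent_coeff (g * f) c"
      unfolding times_ilaurent.rep_eq conv_def
      by (rule sum.reindex_bij_witness[of _ "\<lambda>a. c - a" "\<lambda>a. c - a"]) (auto simp: mult.commute)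
  qed
  show "1 * f = f"
  proof (rule ilaurent_eqI)
    fix c
    have "ilaurent_coeff (1 * f) c = (\<Sum>a\<in>{0}. ilaurent_coeff 1 a * ilaurent_coeff f (c - a))"
      by (rule ilaurent_coeff_times_superset) (auto simp: one_ilaurent.rep_eq split: if_splits)
    then show "ilaurent_coeff (1 * f) c = ilaurent_coeff f c"
      by (simp add: one_ilaurent.rep_eq)
  qed
  show "(f + g) * h = f * h + g * h"
  proof (rule ilaurent_eqI)
    fix c
    let ?F = "\<lambda>f. {a. ilaurent_coeff f a \<noteq> 0 \<and> ilaurent_coeff h (c - a) \<noteq> 0}"
    define S where "S = ?F f \<union> ?F g"
    have S: "finite S" "?F f \<subseteq> S" "?F g \<subseteq> S" "?F (f + g) \<subseteq> S"
      using finite_supp[of f h c] finite_supp[of g h c]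
      by (auto simp: S_def plus_ilaurent.rep_eq)
    show "ilaurent_coeff ((f + g) * h) c = ilaurent_coeff (f * h + g * h) c"
      unfolding plus_ilaurent.rep_eq[of "f * h"]
        ilaurent_coeff_times_superset[OF S(1,2)] ilaurent_coeff_times_superset[OF S(1,3)]
        ilaurent_coeff_times_superset[OF S(1,4)]
      by (simp add: plus_ilaurent.rep_eq algebra_simps sum.distrib)
  qed
  have assoc1: "ilaurent_coeff (f * g * h) e =
      (\<Sum>(c, a) | ilaurent_coeff h (e - c) \<noteq> 0 \<and> ilaurent_coeff f a \<noteq> 0 \<and> ilaurent_coeff g (c - a) \<noteq> 0.
        ilaurent_coeff f a * ilaurent_coeff g (c - a) * ilaurent_coeff h (e - c))"
    (is "_ = sum ?t ?T")
    for f g h :: "('a, 'b) ilaurent" and e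
  proof -
    define FG where
      "FG = {a + b | a b. a \<in> {a. ilaurent_coeff f a \<noteq> 0} \<and> b \<in> {a. ilaurent_coeff g a \<noteq> 0}}"
    define C where "C = {c \<in> FG. e - c \<in> {a. ilaurent_coeff h a \<noteq> 0}}"
    have finC: "finite C" unfolding C_def FG_def
      by (rule wb_finite[OF wb_plus[OF wb_supp wb_supp] wb_supp]) auto
    let ?A = "\<lambda>c. {a. ilaurent_coeff f a \<noteq> 0 \<and> ilaurent_coeff g (c - a) \<noteq> 0}"
    have inFG: "c \<in> FG" if "a \<in> ?A c" for a c
    proof -
      have "c = a + (c - a)" by simp
      then show ?thesis using that unfolding FG_def by blast
    qed
    have T: "?T = Sigma C ?A"
    proof (rule Set.set_eqI)
      fix p :: "(int, 'b) vec \<times> (int, 'b) vec"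
      obtain c a where p: "p = (c, a)" by (cases p)
      show "p \<in> ?T \<longleftrightarrow> p \<in> Sigma C ?A" using inFG[of a c] unfolding p C_def by auto
    qed
    have "{c. ilaurent_coeff (f * g) c \<noteq> 0 \<and> ilaurent_coeff h (e - c) \<noteq> 0} \<subseteq> C"
    proof
      fix c assume c: "c \<in> {c. ilaurent_coeff (f * g) c \<noteq> 0 \<and> ilaurent_coeff h (e - c) \<noteq> 0}"
      then have "conv (ilaurent_coeff f) (ilaurent_coeff g) c \<noteq> 0"
        by (simp add: times_ilaurent.rep_eq)
      then obtain a where "a \<in> ?A c" by (rule conv_nonzeroE) simp
      then show "c \<in> C" using inFG[of a c] c by (simp add: C_def)
    qed
    then have "ilaurent_coeff (f * g * h) e =
        (\<Sum>c\<in>C. ilaurent_coeff (f * g) c * ilaurent_coeff h (e - c))"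
      by (rule ilaurent_coeff_times_superset[OF finC])
    also have "\<dots> = (\<Sum>c\<in>C. \<Sum>a\<in>?A c. ilaurent_coeff f a * ilaurent_coeff g (c - a) * ilaurent_coeff h (e - c))"
      by (simp add: times_ilaurent.rep_eq conv_def sum_distrib_right)
    also have "\<dots> = sum ?t (Sigma C ?A)"
      by (rule sum.Sigma[OF finC]) (use finite_supp in blast)
    finally show "ilaurent_coeff (f * g * h) e = sum ?t ?T" unfolding T .
  qed
  show "f * g * h = f * (g * h)"
  proof (rule ilaurent_eqI)
    fix e
    have "ilaurent_coeff (f * g * h) e = ilaurent_coeff (g * h * f) e"
      unfolding assoc1
      by (rule sum.reindex_bij_witness[of _ "\<lambda>(c, a). (e - c + a, e - c)" "\<lambda>(c, a). (e - a, c - a)"])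
         (auto simp: algebra_simps)
    then show "ilaurent_coeff (f * g * h) e = ilaurent_coeff (f * (g * h)) e"
      by (simp add: comm)
  qed
qed

end

instance ilaurent :: (idom, "{finite, linorder}") idom
proof
  fix f g :: "('a, 'b) ilaurent"
  assume "f \<noteq> 0" "g \<noteq> 0"
  let ?A = "{a. ilaurent_coeff f a \<noteq> 0}" and ?B = "{a. ilaurent_coeff g a \<noteq> 0}"
  have "?A \<noteq> {}" "?B \<noteq> {}"
    using \<open>f \<noteq> 0\<close> \<open>g \<noteq> 0\<close> ilaurent_eqI[of f 0] ilaurent_eqI[of g 0] by (auto simp: zero_ilaurent.rep_eq)
  then obtain m p where mp: "m \<in> ?A" "p \<in> ?B" "\<And>a b. a \<in> ?A \<Longrightarrow> b \<in> ?B \<Longrightarrow> a + b = m + p \<Longrightarrow> a = m"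
    using wb_min[OF wb_supp[of f] wb_supp[of g]] by auto
  have "{a. ilaurent_coeff f a \<noteq> 0 \<and> ilaurent_coeff g (m + p - a) \<noteq> 0} \<subseteq> {m}"
  proof
    fix a assume "a \<in> {a. ilaurent_coeff f a \<noteq> 0 \<and> ilaurent_coeff g (m + p - a) \<noteq> 0}"
    then show "a \<in> {m}" using mp(3)[of a "m + p - a"] by simp
  qed
  then have "ilaurent_coeff (f * g) (m + p) = ilaurent_coeff f m * ilaurent_coeff g p"
    using ilaurent_coeff_times_superset[of "{m}" f g "m + p"] by simp
  also have "\<dots> \<noteq> 0" using mp by simp
  finally show "f * g \<noteq> 0" by (auto simp: zero_ilaurent.rep_eq)
qed


section \<open>Formal power series in several variables\<close>

typedef (overloaded) ('a, 'n::finite) mfps = "UNIV :: (nat ^ 'n \<Rightarrow> 'a) set"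
  morphisms mfps_coeff Abs_mfps
  by simp

setup_lifting type_definition_mfps

lemma mfps_eqI: "(\<And>a. mfps_coeff f a = mfps_coeff g a) \<Longrightarrow> f = g"
  by transfer auto

lemma finite_add_eq: "finite {(a, b). a + b = (c :: nat ^ 'n::finite)}"
proof -
  let ?S = "vec_lambda ` (\<Pi>\<^sub>E i\<in>UNIV. {..c $ i})"
  have S: "a \<in> ?S" if "\<And>i. a $ i \<le> c $ i" for a
    using that by (intro image_eqI[of _ _ "vec_nth a"]) auto
  have "{(a, b). a + b = c} \<subseteq> ?S \<times> ?S" using S by fastforce
  moreover have "finite ?S" by (intro finite_imageI finite_PiE) auto
  ultimately show ?thesis by (meson finite_SigmaI finite_subset)
qed

text \<open>
  The coefficients, in the variables \<open>t_i = x_i^(1/d)\<close>, of a power series in the variables \<open>x_i\<close>.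
\<close>

definition scale_exp :: "nat \<Rightarrow> nat ^ 'n::finite \<Rightarrow> int ^ 'n" where
  "scale_exp d b = (\<chi> i. int d * int (b $ i))"

lift_definition of_mfps :: "nat \<Rightarrow> ('a::zero, 'n::{finite, linorder}) mfps \<Rightarrow> ('a, 'n) ilaurent" is
  "\<lambda>d f a. if a \<in> range (scale_exp d) then f (\<chi> i. nat (a $ i div int d)) else 0"
proof -
  fix d and f :: "(nat, 'n) vec \<Rightarrow> 'a"
  have *: "wb is A" if "\<forall>a\<in>A. \<forall>i. 0 \<le> a $ i" for "is" :: "'n list" and A
    using that by (induction "is" arbitrary: A) auto
  show "(\<lambda>a. if a \<in> range (scale_exp d) then f (\<chi> i. nat (a $ i div int d)) else 0) \<in> iter_laurent vars"
    unfolding iter_laurent_vars_iff by (rule *) (auto simp: scale_exp_def)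
qed

lemma of_mfps_coeff [simp]:
  "d > 0 \<Longrightarrow> ilaurent_coeff (of_mfps d f) (scale_exp d b) = mfps_coeff f b"
  by transfer (auto simp: scale_exp_def)

lemma of_mfps_coeff_eq_0:
  "a \<notin> range (scale_exp d) \<Longrightarrow> ilaurent_coeff (of_mfps d f) a = 0"
  by transfer auto

lemma of_mfps_inj: "d > 0 \<Longrightarrow> of_mfps d f = of_mfps d g \<Longrightarrow> f = g"
  by (rule mfps_eqI) (metis of_mfps_coeff)

lemma scale_exp_add: "scale_exp d (a + b) = scale_exp d a + scale_exp d b"
  by (simp add: scale_exp_def vec_eq_iff algebra_simps)

lemma inj_scale_exp: "d > 0 \<Longrightarrow> scale_exp d a = scale_exp d b \<longleftrightarrow> a = b"
  by (simp add: scale_exp_def vec_eq_iff)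

lemma scale_exp_0 [simp]: "scale_exp d 0 = 0"
  by (simp add: scale_exp_def vec_eq_iff)

lemma of_mfps_eqI:
  assumes "\<And>b. ilaurent_coeff F (scale_exp d b) = ilaurent_coeff G (scale_exp d b)"
    and "\<And>a. a \<notin> range (scale_exp d) \<Longrightarrow> ilaurent_coeff F a = 0"
    and "\<And>a. a \<notin> range (scale_exp d) \<Longrightarrow> ilaurent_coeff G a = 0"
  shows "F = G"
  using assms by (intro ilaurent_eqI) (metis rangeE)

instantiation mfps :: (comm_ring_1, "{finite, linorder}") "{zero, one, plus, uminus, minus, times}"
begin

lift_definition zero_mfps :: "('a, 'b) mfps" is "\<lambda>_. 0" .

lift_definition one_mfps :: "('a, 'b) mfps" is "\<lambda>a. if a = 0 then 1 else 0" .

lift_definition plus_mfps :: "('a, 'b) mfps \<Rightarrow> ('a, 'b) mfps \<Rightarrow> ('a, 'b) mfps"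
  is "\<lambda>f g a. f a + g a" .

lift_definition uminus_mfps :: "('a, 'b) mfps \<Rightarrow> ('a, 'b) mfps"
  is "\<lambda>f a. - f a" .

lift_definition minus_mfps :: "('a, 'b) mfps \<Rightarrow> ('a, 'b) mfps \<Rightarrow> ('a, 'b) mfps"
  is "\<lambda>f g a. f a - g a" .

lift_definition times_mfps :: "('a, 'b) mfps \<Rightarrow> ('a, 'b) mfps \<Rightarrow> ('a, 'b) mfps"
  is "\<lambda>f g c. \<Sum>(a, b) | a + b = c. f a * g b" .

instance ..

end

lemma of_mfps_0 [simp]: "of_mfps d 0 = 0"
  by transfer auto

lemma of_mfps_1 [simp]: "d > 0 \<Longrightarrow> of_mfps d 1 = 1"
proof (rule of_mfps_eqI[of _ d])
  fix b :: "(nat, 'b) vec" assume "d > 0"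
  then show "ilaurent_coeff (of_mfps d 1) (scale_exp d b) = ilaurent_coeff 1 (scale_exp d b)"
    using inj_scale_exp[of d b 0] by (simp add: one_mfps.rep_eq one_ilaurent.rep_eq)
qed (auto simp: of_mfps_coeff_eq_0 one_ilaurent.rep_eq image_iff, metis scale_exp_0)

lemma of_mfps_add [simp]: "of_mfps d (f + g) = of_mfps d f + of_mfps d g"
  by transfer auto

lemma of_mfps_uminus [simp]: "of_mfps d (- f) = - of_mfps d f"
  by transfer auto

lemma of_mfps_diff [simp]: "of_mfps d (f - g) = of_mfps d f - of_mfps d g"
  by transfer auto

lemma of_mfps_mult [simp]:
  fixes f g :: "('a::comm_ring_1, 'b::{finite, linorder}) mfps"
  assumes d: "d > 0"
  shows "of_mfps d (f * g) = of_mfps d f * of_mfps d g"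
proof (rule of_mfps_eqI[of _ d])
  let ?F = "ilaurent_coeff (of_mfps d f)" and ?G = "ilaurent_coeff (of_mfps d g)"
  fix c :: "(nat, 'b) vec"
  let ?S = "(\<lambda>(a, b). scale_exp d a) ` {(a, b). a + b = c}"
  have "{a. ?F a \<noteq> 0 \<and> ?G (scale_exp d c - a) \<noteq> 0} \<subseteq> ?S"
  proof
    fix a assume "a \<in> {a. ?F a \<noteq> 0 \<and> ?G (scale_exp d c - a) \<noteq> 0}"
    then obtain u v where uv: "a = scale_exp d u" "scale_exp d c - a = scale_exp d v"
      using of_mfps_coeff_eq_0 by blast
    then have "scale_exp d (u + v) = scale_exp d c" by (simp add: scale_exp_add algebra_simps)
    then have "u + v = c" using inj_scale_exp[OF d] by blast
    then show "a \<in> ?S" using uv(1) by force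
  qed
  then have "ilaurent_coeff (of_mfps d f * of_mfps d g) (scale_exp d c)
      = (\<Sum>a\<in>?S. ?F a * ?G (scale_exp d c - a))"
    by (intro ilaurent_coeff_times_superset) (auto intro: finite_add_eq)
  also have "\<dots> = (\<Sum>(a, b) | a + b = c. mfps_coeff f a * mfps_coeff g b)"
  proof (subst sum.reindex)
    show "inj_on (\<lambda>(a, b). scale_exp d a) {(a, b). a + b = c}"
      by (auto simp: inj_on_def inj_scale_exp[OF d])
    show "sum ((\<lambda>a. ?F a * ?G (scale_exp d c - a)) \<circ> (\<lambda>(a, b). scale_exp d a)) {(a, b). a + b = c}
        = (\<Sum>(a, b) | a + b = c. mfps_coeff f a * mfps_coeff g b)"
      by (rule sum.cong) (auto simp: scale_exp_add d)
  qed
  finally show "ilaurent_coeff (of_mfps d (f * g)) (scale_exp d c)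
      = ilaurent_coeff (of_mfps d f * of_mfps d g) (scale_exp d c)"
    by (simp add: d times_mfps.rep_eq)
next
  fix a :: "(int, 'b) vec" assume a: "a \<notin> range (scale_exp d)"
  show "ilaurent_coeff (of_mfps d (f * g)) a = 0" by (rule of_mfps_coeff_eq_0[OF a])
  have "\<not> (ilaurent_coeff (of_mfps d f) b \<noteq> 0 \<and> ilaurent_coeff (of_mfps d g) (a - b) \<noteq> 0)" for b
  proof
    assume "ilaurent_coeff (of_mfps d f) b \<noteq> 0 \<and> ilaurent_coeff (of_mfps d g) (a - b) \<noteq> 0"
    then obtain u v where "b = scale_exp d u" "a - b = scale_exp d v"
      using of_mfps_coeff_eq_0 by blast
    then have "a = scale_exp d (u + v)" by (simp add: scale_exp_add algebra_simps)
    then show False using a by blast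
  qed
  then show "ilaurent_coeff (of_mfps d f * of_mfps d g) a = 0"
    using ilaurent_coeff_times_superset[of "{}" "of_mfps d f" "of_mfps d g" a] by auto
qed

instance mfps :: (comm_ring_1, "{finite, linorder}") comm_ring_1
proof
  fix f g h :: "('a, 'b) mfps"
  show "f + g + h = f + (g + h)" "f + g = g + f" "0 + f = f" "- f + f = 0" "f - g = f + - g"
    by (transfer; simp add: algebra_simps)+
  show "(0 :: ('a, 'b) mfps) \<noteq> 1" by transfer (metis zero_neq_one)
  show "f * g * h = f * (g * h)" "f * g = g * f" "1 * f = f" "(f + g) * h = f * h + g * h"
    by (rule of_mfps_inj[of 1]; simp add: algebra_simps)+
qed

instance mfps :: (idom, "{finite, linorder}") idom
proof
  fix f g :: "('a, 'b) mfps"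
  assume "f \<noteq> 0" "g \<noteq> 0"
  then have "of_mfps 1 f * of_mfps 1 g \<noteq> 0"
    using of_mfps_inj[of 1 f 0] of_mfps_inj[of 1 g 0] by auto
  then show "f * g \<noteq> 0" by (metis of_mfps_0 of_mfps_mult zero_less_one)
qed


section \<open>Newton diagrams and cones\<close>

text \<open>
  The Newton diagram of \<open>f\<close> viewed as an element of \<open>K_{n,d}\<close>.
\<close>

definition newton_diagram :: "nat \<Rightarrow> ('a::zero, 'n::{finite, linorder}) ilaurent \<Rightarrow> ((real, 'n) vec) set" where
  "newton_diagram d f = {(\<chi> i. real_of_int (a $ i) / real d) | a. ilaurent_coeff f a \<noteq> 0}"

definition cone_over :: "(real ^ 'n::finite) set \<Rightarrow> (real ^ 'n) set" where
  "cone_over \<Delta> = (\<Union>a\<in>\<Delta>. {l *\<^sub>R a | l. 0 \<le> l})"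

definition polyhedral_cone :: "(real ^ 'n::finite) set \<Rightarrow> bool" where
  "polyhedral_cone \<Gamma> \<longleftrightarrow>
     (\<exists>\<Delta> u b. u \<noteq> 0 \<and> b \<noteq> 0 \<and> \<Delta> \<subseteq> {v. u \<bullet> v = b} \<and> compact \<Delta> \<and> polyhedron \<Delta> \<and>
        top_of_set {v. u \<bullet> v = b} interior_of \<Delta> \<noteq> {} \<and> \<Gamma> = cone_over \<Delta>)"

text \<open>
  The map \<open>blowup i j\<close> is order-preserving for the lexicographic order iff \<open>i < j\<close>.
\<close>

definition blowup :: "'n::finite \<Rightarrow> 'n \<Rightarrow> real ^ 'n \<Rightarrow> real ^ 'n" where
  "blowup i j a = (\<chi> l. if l = j then a $ i + a $ j else a $ l)"

definition S_cone :: "(real ^ 'n::{finite, linorder}) set \<Rightarrow> bool" where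
  "S_cone \<Gamma> \<longleftrightarrow> polyhedral_cone \<Gamma> \<and>
     (\<exists>bs. (\<forall>(i, j)\<in>set bs. i < j) \<and>
        fold (\<lambda>(i, j). blowup i j) bs ` \<Gamma> \<subseteq> {v. \<forall>l. 0 \<le> v $ l})"

end

theory Submission
  imports Defs
begin

text \<open>
  The series whose exponents have bounded denominators and lie in a cone that order-preserving
  monomial blowing-ups carry into the first quadrant form a ring which behaves like a Henselian
  valuation ring with residue field \<open>k\<close> and divisible value group, and over such a ring every
  monic polynomial splits into linear factors. Two facts make this work.

  First, such a series is, after more blowing-ups, a monomial times a unit: the lexicographically
  smallest exponent wins, since enough blowing-ups move its differences to all the other exponents
  into the quadrant (\<open>tilted_orthant_dominant\<close>). Instead of arbitrary sequences of
  blowing-ups, one chain of cones with a single parameter \<open>N\<close>, the tilted orthants, is enough.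

  Second, the series supported in one fixed such cone satisfy Hensel's lemma: a factorisation of
  the residue polynomial, taken at the exponent \<open>0\<close>, into coprime monic factors lifts
  (\<open>hensel_factorization\<close>). The factors are built exponent by exponent, along a weight that is
  additive on the cone.

  The splitting is then an induction on the degree \<open>m\<close>. A shift of \<open>z\<close> removes the term of degree
  \<open>m - 1\<close>; here characteristic zero enters. Unless only \<open>z^m\<close> remains, let \<open>\<gamma>\<close> be the smallest of
  the slopes \<open>v(w_i) / i\<close>, where \<open>v\<close> is the lexicographically smallest exponent, and substitute
  \<open>x^\<gamma> z\<close> for \<open>z\<close>. After division by \<open>x^(m \<gamma>)\<close> all coefficients lie in one of the rings, and the
  residue polynomial has a nonzero coefficient below the leading one, but none in degree \<open>m - 1\<close>
  (\<open>newton_slope\<close>). So it is not the power of one linear factor, and, \<open>k\<close> being algebraically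
  closed, it splits into two coprime factors (\<open>coprime_factors_of_depressed\<close>). Hensel's lemma lifts
  them to factors of smaller degree. Denominators grow only when a slope is formed, by a divisor
  of \<open>m!\<close>, so their product over all degrees can be provided from the start.
\<close>

section \<open>Tilted orthants\<close>

lemma finite_linorder_induct [case_names less]:
  fixes l :: "'n::{finite, linorder}"
  assumes "\<And>l. (\<And>j. j < l \<Longrightarrow> P j) \<Longrightarrow> P l"
  shows "P l"
proof (induction l rule: measure_induct_rule[of "\<lambda>l. card {..<l}"])
  case (less l)
  show ?case
    by (rule assms, rule less) (auto intro!: psubset_card_mono)
qed

text \<open>
  The effect of the blowing-ups from \<open>j\<close> to \<open>l\<close>, each repeated \<open>N\<close> times, for all \<open>j < l\<close>, with \<open>l\<close>
  running upwards: by the time \<open>l\<close> is treated, the coordinates below it have their final values,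
  which gives the recursion. See \<open>fold_blowup_tilt\<close>.
\<close>

function tilt :: "nat \<Rightarrow> 'b::comm_ring_1 ^ 'n::{finite, linorder} \<Rightarrow> 'n \<Rightarrow> 'b" where
  "tilt N a l = a $ l + of_nat N * (\<Sum>j\<in>{..<l}. tilt N a j)"
  by pat_completeness auto
termination
  by (relation "Wellfounded.measure (\<lambda>(N, a, l). card {..<l})") (auto intro!: psubset_card_mono)

declare tilt.simps [simp del]

lemma tilt_0_left [simp]: "tilt 0 a l = a $ l"
  by (simp add: tilt.simps[of 0 a l])

lemma tilt_add: "tilt N (a + b) l = tilt N a l + tilt N b l"
proof (induction N a l rule: tilt.induct)
  case (1 N a l)
  then have "(\<Sum>j\<in>{..<l}. tilt N (a + b) j) = (\<Sum>j\<in>{..<l}. tilt N a j) + (\<Sum>j\<in>{..<l}. tilt N b j)"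
    by (simp add: sum.distrib)
  then show ?case
    by (simp add: tilt.simps[of N a l] tilt.simps[of N b l] tilt.simps[of N "a + b" l] algebra_simps)
qed

lemma tilt_smult: "tilt N (c *s a) l = c * tilt N a l"
proof (induction N a l rule: tilt.induct)
  case (1 N a l)
  then have "(\<Sum>j\<in>{..<l}. tilt N (c *s a) j) = c * (\<Sum>j\<in>{..<l}. tilt N a j)"
    by (simp add: sum_distrib_left)
  then show ?case
    by (simp add: tilt.simps[of N a l] tilt.simps[of N "c *s a" l] algebra_simps)
qed

lemma tilt_0 [simp]: "tilt N 0 l = 0"
  using tilt_smult[of N 0 0 l] by (simp add: vec_eq_iff)

lemma tilt_diff: "tilt N (a - b) l = tilt N a l - tilt N b l"
  using tilt_add[of N "a - b" b l] by (simp add: algebra_simps)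

lemma tilt_of_int: "tilt N (\<chi> i. of_int (a $ i)) l = of_int (tilt N a l)"
proof (induction N a l rule: tilt.induct)
  case (1 N a l)
  then show ?case
    by (simp add: tilt.simps[of N a l] tilt.simps[of N "\<chi> i. of_int (a $ i)" l])
qed

lemma tilt_cong:
  assumes "\<And>j. j \<le> l \<Longrightarrow> a $ j = b $ j"
  shows "tilt N a l = tilt N b l"
  using assms
proof (induction N a l rule: tilt.induct)
  case (1 N a l)
  have "tilt N a j = tilt N b j" if "j \<in> {..<l}" for j
    using 1 that by auto
  then show ?case
    by (simp add: tilt.simps[of N a l] tilt.simps[of N b l] 1)
qed

lemma tilt_eq_0_imp:
  assumes "\<And>l. tilt N a l = 0"
  shows "a = 0"
proof -
  have "a $ l = 0" for l
    using tilt.simps[of N a l] assms by simp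
  then show ?thesis by (simp add: vec_eq_iff)
qed

text \<open>
  On its own orthant every tilted coordinate grows with \<open>N\<close>, because all the summands in its
  recursion are nonnegative. So the cones \<open>{a. \<forall>l. 0 \<le> tilt N a l}\<close> form an increasing chain.
\<close>

lemma tilt_mono:
  fixes a :: "'b::linordered_idom ^ 'n::{finite, linorder}"
  assumes "\<And>l. 0 \<le> tilt N a l" "N \<le> N'"
  shows "tilt N a l \<le> tilt N' a l"
  using assms
proof (induction N a l rule: tilt.induct)
  case (1 N a l)
  then have "(\<Sum>j\<in>{..<l}. tilt N a j) \<le> (\<Sum>j\<in>{..<l}. tilt N' a j)"
    by (intro sum_mono) blast
  moreover have "0 \<le> (\<Sum>j\<in>{..<l}. tilt N a j)"
    using 1 by (intro sum_nonneg) blast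
  ultimately have "of_nat N * (\<Sum>j\<in>{..<l}. tilt N a j) \<le> of_nat N' * (\<Sum>j\<in>{..<l}. tilt N' a j)"
    using 1 by (intro mult_mono) auto
  then show ?case
    by (simp add: tilt.simps[of N a l] tilt.simps[of N' a l])
qed

text \<open>
  A lexicographically positive vector is pushed into the orthant by enough tilting: the leading
  entry, being at least \<open>1\<close>, enters all later tilted coordinates with the weight that has been
  added. How much is needed depends on a lower bound for the tilted coordinates only.
\<close>

lemma tilt_nonneg_of_lex_pos:
  fixes a :: "int ^ 'n::{finite, linorder}"
  assumes lower: "\<And>l. - int K \<le> tilt N a l"
    and pos: "0 < a $ i" and lead: "\<And>j. j < i \<Longrightarrow> a $ j = 0"
  shows "0 \<le> tilt (N + K) a l"
proof -
  have before: "tilt M a j = 0" if "j < i" for M j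
    using tilt_cong[of j a 0 M] lead that by simp
  have at: "tilt M a i = a $ i" for M
    using before by (simp add: tilt.simps[of M a i])
  have after: "tilt N a l + int K \<le> tilt (N + K) a l" if "i < l" for l
    using that
  proof (induction l rule: finite_linorder_induct)
    case (less l)
    have IH: "tilt N a j + int K \<le> tilt (N + K) a j" if "i < j" "j < l" for j
      using less that by blast
    let ?S = "\<Sum>j\<in>{..<l}. tilt N a j" and ?S' = "\<Sum>j\<in>{..<l}. tilt (N + K) a j"
    have nonneg: "0 \<le> tilt (N + K) a j" if "j < l" for j
      using before[of j] at pos IH[of j] lower[of j] that by (cases j i rule: linorder_cases) auto
    have "tilt N a j \<le> tilt (N + K) a j" if "j < l" for j
      using before[of j] at IH[of j] that by (cases j i rule: linorder_cases) auto
    then have "?S \<le> ?S'" by (intro sum_mono) simp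
    moreover have "1 \<le> ?S'"
    proof -
      have "tilt (N + K) a i \<le> ?S'"
        using nonneg less by (intro member_le_sum) auto
      then show ?thesis using at[of "N + K"] pos by linarith
    qed
    ultimately have "int N * ?S + int K * 1 \<le> int N * ?S' + int K * ?S'"
      by (intro add_mono mult_left_mono) auto
    then show ?case
      unfolding tilt.simps[of N a l] tilt.simps[of "N + K" a l] of_nat_add distrib_right by linarith
  qed
  show ?thesis
    using before[of l] at pos after[of l] lower[of l] by (cases l i rule: linorder_cases) auto
qed

definition tilted_orthant :: "nat \<Rightarrow> (int ^ 'n::{finite, linorder}) set" where
  "tilted_orthant N = {a. \<forall>l. 0 \<le> tilt N a l}"

lemma tilted_orthant_mono: "N \<le> N' \<Longrightarrow> tilted_orthant N \<subseteq> tilted_orthant N'"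
  using tilt_mono unfolding tilted_orthant_def by (blast intro: order_trans)

lemma tilted_orthant_0 [simp]: "0 \<in> tilted_orthant N"
  by (simp add: tilted_orthant_def)

lemma tilted_orthant_add: "a \<in> tilted_orthant N \<Longrightarrow> b \<in> tilted_orthant N \<Longrightarrow> a + b \<in> tilted_orthant N"
  by (simp add: tilted_orthant_def tilt_add)

lemma tilted_orthant_smult_iff: "0 < c \<Longrightarrow> c *s a \<in> tilted_orthant N \<longleftrightarrow> a \<in> tilted_orthant N"
  by (simp add: tilted_orthant_def tilt_smult zero_le_mult_iff)

text \<open>
  Once the coordinates before \<open>l\<close> are fixed, the condition \<open>0 \<le> tilt N a l\<close> is a lower bound for
  \<open>a $ l\<close>.
\<close>

lemma wb_tilted_orthant: "wb vars (tilted_orthant N :: (int ^ 'n::{finite, linorder}) set)"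
proof -
  have "wb is A" if "sorted_wrt (<) is" "A \<subseteq> tilted_orthant N"
    "\<And>a b l. a \<in> A \<Longrightarrow> b \<in> A \<Longrightarrow> l \<notin> set is \<Longrightarrow> a $ l = b $ l" for "is" and A :: "(int, 'n) vec set"
    using that
  proof (induction "is" arbitrary: A)
    case (Cons i "is")
    have "wb is {a \<in> A. a $ i = c}" for c
    proof (rule Cons.IH)
      show "a $ l = b $ l" if "a \<in> {a \<in> A. a $ i = c}" "b \<in> {a \<in> A. a $ i = c}" "l \<notin> set is" for a b l
        using that Cons.prems(3)[of a b l] by (cases "l = i") auto
    qed (use Cons.prems in auto)
    moreover have "\<exists>K. \<forall>a\<in>A. K \<le> a $ i"
    proof (cases "A = {}")
      case False
      then obtain b where b: "b \<in> A" by blast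
      have "- (int N * (\<Sum>j\<in>{..<i}. tilt N b j)) \<le> a $ i" if a: "a \<in> A" for a
      proof -
        have "a $ j = b $ j" if "j < i" for j
          using Cons.prems(1) that by (intro Cons.prems(3)[OF a b]) auto
        then have "tilt N a j = tilt N b j" if "j < i" for j
          using that by (intro tilt_cong) auto
        moreover have "0 \<le> tilt N a i" using Cons.prems(2) a by (auto simp: tilted_orthant_def)
        ultimately show ?thesis by (simp add: tilt.simps[of N a i])
      qed
      then show ?thesis by blast
    qed simp
    ultimately show ?case by simp
  qed simp
  from this[of vars "tilted_orthant N"] show ?thesis by simp
qed

text \<open>
  The lexicographic minimum is found one variable at a time: the entries at the first variable are
  bounded below, and the vectors with the least entry there pose the same problem for the
  remaining variables.
\<close>

lemma wb_lex_min:
  fixes A :: "(int ^ 'n::{finite, linorder}) set"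
  assumes "wb vars A" "A \<noteq> {}"
  obtains m where "m \<in> A"
    "\<And>b. b \<in> A \<Longrightarrow> b \<noteq> m \<Longrightarrow> \<exists>i. m $ i < b $ i \<and> (\<forall>j<i. b $ j = m $ j)"
proof -
  have "\<exists>m\<in>A. \<forall>b\<in>A. b \<noteq> m \<longrightarrow> (\<exists>i. m $ i < b $ i \<and> (\<forall>j<i. b $ j = m $ j))"
    if "sorted_wrt (<) is" "wb is A" "A \<noteq> {}"
    "\<And>a b l. a \<in> A \<Longrightarrow> b \<in> A \<Longrightarrow> l \<notin> set is \<Longrightarrow> a $ l = b $ l" for "is" and A :: "(int, 'n) vec set"
    using that
  proof (induction "is" arbitrary: A)
    case Nil
    then show ?case by (metis all_not_in_conv empty_iff empty_set vec_eq_iff)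
  next
    case (Cons i "is")
    obtain K where K: "\<And>a. a \<in> A \<Longrightarrow> K \<le> a $ i" using Cons.prems(2) by auto
    obtain y where "y \<in> A" using Cons.prems(3) by blast
    then obtain x where x: "x \<in> A" "\<And>a. a \<in> A \<Longrightarrow> nat (x $ i - K) \<le> nat (a $ i - K)"
      using ex_has_least_nat[of "\<lambda>a. a \<in> A" y "\<lambda>a. nat (a $ i - K)"] by blast
    have x': "x $ i \<le> a $ i" if "a \<in> A" for a
      using x(2)[OF that] K[OF that] K[OF x(1)] by simp
    have "\<exists>m\<in>{a \<in> A. a $ i = x $ i}. \<forall>b\<in>{a \<in> A. a $ i = x $ i}. b \<noteq> m \<longrightarrow>
        (\<exists>i. m $ i < b $ i \<and> (\<forall>j<i. b $ j = m $ j))"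
    proof (rule Cons.IH)
      show "a $ l = b $ l" if "a \<in> {a \<in> A. a $ i = x $ i}" "b \<in> {a \<in> A. a $ i = x $ i}"
        "l \<notin> set is" for a b l
        using that Cons.prems(4)[of a b l] by (cases "l = i") auto
    qed (use Cons.prems x in auto)
    then obtain m where m: "m \<in> A" "m $ i = x $ i" and min: "\<And>b. b \<in> A \<Longrightarrow> b $ i = x $ i \<Longrightarrow>
        b \<noteq> m \<Longrightarrow> \<exists>i. m $ i < b $ i \<and> (\<forall>j<i. b $ j = m $ j)" by blast
    have "\<exists>i. m $ i < b $ i \<and> (\<forall>j<i. b $ j = m $ j)" if b: "b \<in> A" "b \<noteq> m" for b
    proof (cases "b $ i = x $ i")
      case False
      then have "m $ i < b $ i" using x'[OF b(1)] m(2) by simp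
      moreover have "b $ j = m $ j" if "j < i" for j
        using Cons.prems(1) that by (intro Cons.prems(4)[OF b(1) m(1)]) auto
      ultimately show ?thesis by blast
    qed (use min b in blast)
    then show ?case using m(1) by blast
  qed
  from this[of vars A] assms that show ?thesis by auto
qed

text \<open>
  This replaces the monomialisation of a series by blowing up: if \<open>S\<close> is the set of
  exponents of a series, then after further tilting the series is the monomial with exponent \<open>m\<close> times a unit.
\<close>

lemma tilted_orthant_dominant:
  fixes S :: "(int ^ 'n::{finite, linorder}) set"
  assumes S: "S \<subseteq> tilted_orthant N" "S \<noteq> {}"
  obtains m N' where "m \<in> S" "N \<le> N'" "\<And>b. b \<in> S \<Longrightarrow> b - m \<in> tilted_orthant N'"
proof -
  have "wb vars S" by (rule wb_mono[OF wb_tilted_orthant S(1)])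
  then obtain m where m: "m \<in> S"
    and min: "\<And>b. b \<in> S \<Longrightarrow> b \<noteq> m \<Longrightarrow> \<exists>i. m $ i < b $ i \<and> (\<forall>j<i. b $ j = m $ j)"
    using wb_lex_min S(2) by blast
  define K where "K = nat (\<Sum>l\<in>UNIV. tilt N m l)"
  have m0: "0 \<le> tilt N m l" for l using m S(1) by (auto simp: tilted_orthant_def)
  have K: "tilt N m l \<le> int K" for l
  proof -
    have "tilt N m l \<le> (\<Sum>l\<in>UNIV. tilt N m l)" using m0 by (intro member_le_sum) auto
    then show ?thesis unfolding K_def by simp
  qed
  have "b - m \<in> tilted_orthant (N + K)" if b: "b \<in> S" for b
  proof (cases "b = m")
    case False
    then obtain i where i: "m $ i < b $ i" "\<And>j. j < i \<Longrightarrow> b $ j = m $ j" using min b by blast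
    \<comment> \<open>\<open>b\<close> itself is in the orthant, so subtracting \<open>m\<close> costs at most the tilted coordinates of \<open>m\<close>\<close>
    have "- int K \<le> tilt N (b - m) l" for l
    proof -
      have "0 \<le> tilt N b l" using b S(1) by (auto simp: tilted_orthant_def)
      then show ?thesis using K[of l] by (simp add: tilt_diff)
    qed
    then show ?thesis
      unfolding tilted_orthant_def using i tilt_nonneg_of_lex_pos[of K N "b - m" i] by simp
  qed simp
  then show thesis using that[of m "N + K"] m by simp
qed

section \<open>Laurent monomials and series supported in a monoid\<close>

lift_definition laurent_monom :: "'a::zero \<Rightarrow> (int, 'n::{finite, linorder}) vec \<Rightarrow> ('a, 'n) ilaurent" is
  "\<lambda>c a b. if b = a then c else 0"
proof -
  fix c :: 'a and a :: "(int, 'n) vec"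
  show "(\<lambda>b. if b = a then c else 0) \<in> iter_laurent vars"
    unfolding iter_laurent_vars_iff by (rule wb_mono[OF wb_singleton[of _ a]]) auto
qed

lemma coeff_laurent_monom_mult [simp]:
  "ilaurent_coeff (laurent_monom c a * f) b = c * ilaurent_coeff f (b - a)"
proof -
  have "ilaurent_coeff (laurent_monom c a * f) b =
      (\<Sum>u\<in>{a}. ilaurent_coeff (laurent_monom c a) u * ilaurent_coeff f (b - u))"
    by (rule ilaurent_coeff_times_superset) (auto simp: laurent_monom.rep_eq split: if_splits)
  then show ?thesis by (simp add: laurent_monom.rep_eq)
qed

lemma laurent_monom_0: "laurent_monom 1 0 = 1"
  by transfer auto

lemma laurent_monom_mult: "laurent_monom c a * laurent_monom d b = laurent_monom (c * d) (a + b)"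
  by (rule ilaurent_eqI) (auto simp: laurent_monom.rep_eq algebra_simps)

lemma laurent_monom_power: "laurent_monom 1 a ^ j = laurent_monom 1 (of_nat j *s a)"
  by (induction j) (auto simp: laurent_monom_0 laurent_monom_mult vec_eq_iff algebra_simps)

lemma laurent_monom_neq_0: "laurent_monom (1::'a::comm_ring_1) a \<noteq> 0"
proof
  assume "laurent_monom (1::'a) a = 0"
  then have "ilaurent_coeff (laurent_monom (1::'a) a) a = ilaurent_coeff 0 a" by simp
  then show False by (simp add: laurent_monom.rep_eq zero_ilaurent.rep_eq)
qed

lemma ilaurent_coeff_of_nat_mult: "ilaurent_coeff (of_nat m * f) a = of_nat m * ilaurent_coeff f a"
  by (induction m) (auto simp: zero_ilaurent.rep_eq plus_ilaurent.rep_eq distrib_right)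

lemma ilaurent_coeff_sum: "ilaurent_coeff (\<Sum>i\<in>I. f i) a = (\<Sum>i\<in>I. ilaurent_coeff (f i) a)"
  by (induction I rule: infinite_finite_induct) (auto simp: zero_ilaurent.rep_eq plus_ilaurent.rep_eq)

definition supported :: "(int, 'n::{finite, linorder}) vec set \<Rightarrow> ('a::zero, 'n) ilaurent set" where
  "supported M = {f. \<forall>a. ilaurent_coeff f a \<noteq> 0 \<longrightarrow> a \<in> M}"

lemma supported_mono: "M \<subseteq> M' \<Longrightarrow> supported M \<subseteq> supported M'"
  unfolding supported_def by blast

lemma supported_0 [simp]: "0 \<in> supported M"
  by (simp add: supported_def zero_ilaurent.rep_eq)

lemma supported_laurent_monom: "a \<in> M \<Longrightarrow> laurent_monom c a \<in> supported M"
  by (simp add: supported_def laurent_monom.rep_eq)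

lemma supported_add: "f \<in> supported M \<Longrightarrow> g \<in> supported M \<Longrightarrow> f + g \<in> supported M"
  by (simp add: supported_def plus_ilaurent.rep_eq) (metis add_0)

lemma supported_mult:
  assumes "f \<in> supported M" "g \<in> supported M" "\<And>a b. a \<in> M \<Longrightarrow> b \<in> M \<Longrightarrow> a + b \<in> M"
  shows "f * g \<in> supported M"
  unfolding supported_def
proof (intro CollectI allI impI)
  fix c assume "ilaurent_coeff (f * g) c \<noteq> 0"
  then obtain a where "ilaurent_coeff f a \<noteq> 0" "ilaurent_coeff g (c - a) \<noteq> 0"
    unfolding times_ilaurent.rep_eq by (rule conv_nonzeroE)
  then have "a + (c - a) \<in> M" using assms unfolding supported_def by blast
  then show "c \<in> M" by simp
qed

text \<open>
  A polynomial over the Laurent series is also a Laurent series with polynomial coefficients;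
  this is its coefficient at the exponent \<open>a\<close>. The residue polynomial is the slice at \<open>0\<close>.
\<close>

definition slice :: "(int, 'n::{finite, linorder}) vec \<Rightarrow> ('a::comm_ring_1, 'n) ilaurent poly \<Rightarrow> 'a poly" where
  "slice a = map_poly (\<lambda>f. ilaurent_coeff f a)"

lemma coeff_slice [simp]: "Polynomial.coeff (slice a p) i = ilaurent_coeff (Polynomial.coeff p i) a"
  unfolding slice_def by (simp add: coeff_map_poly zero_ilaurent.rep_eq)

lemma poly_eq_slices: "(\<And>a. slice a p = slice a q) \<Longrightarrow> p = q"
  by (intro poly_eqI ilaurent_eqI) (metis coeff_slice)

lemma degree_slice_le: "Polynomial.degree (slice a p) \<le> Polynomial.degree p"
  by (rule degree_le) (simp add: coeff_eq_0 zero_ilaurent.rep_eq)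

lemma slice_0_monic:
  fixes p :: "('a::comm_ring_1, 'n::{finite, linorder}) ilaurent poly"
  assumes "Polynomial.lead_coeff p = 1"
  shows "Polynomial.degree (slice 0 p) = Polynomial.degree p" "Polynomial.lead_coeff (slice 0 p) = 1"
proof -
  have c: "Polynomial.coeff (slice 0 p) (Polynomial.degree p) = 1"
    using assms by (simp add: one_ilaurent.rep_eq)
  then have "Polynomial.degree p \<le> Polynomial.degree (slice 0 p)" by (intro le_degree) auto
  then show "Polynomial.degree (slice 0 p) = Polynomial.degree p"
    using degree_slice_le[of 0 p] by simp
  then show "Polynomial.lead_coeff (slice 0 p) = 1" using c by simp
qed

lemma degree_slice_less:
  fixes p :: "('a::comm_ring_1, 'n::{finite, linorder}) ilaurent poly"
  assumes "Polynomial.lead_coeff p = 1" "a \<noteq> 0" "0 < Polynomial.degree p"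
  shows "Polynomial.degree (slice a p) < Polynomial.degree p"
proof -
  have "Polynomial.coeff (slice a p) (Polynomial.degree p) = 0"
    using assms by (simp add: one_ilaurent.rep_eq)
  then show ?thesis using degree_slice_le[of a p] assms(3)
    by (metis bot_nat_0.not_eq_extremum degree_0 le_neq_implies_less leading_coeff_0_iff)
qed

abbreviation coeffs_in :: "'a::zero set \<Rightarrow> 'a poly \<Rightarrow> bool" where
  "coeffs_in A p \<equiv> \<forall>i. Polynomial.coeff p i \<in> A"

lemma slice_eq_0: "coeffs_in (supported M) p \<Longrightarrow> a \<notin> M \<Longrightarrow> slice a p = 0"
  by (rule poly_eqI) (auto simp: supported_def)

section \<open>Hensel's lemma\<close>

text \<open>
  The weight makes \<open>M\<close> behave like \<open>\<nat>\<close> for recursion: in a decomposition \<open>a = b + c\<close> into nonzero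
  elements both parts have smaller weight than \<open>a\<close>. That \<open>a\<close> has only finitely many decompositions
  comes from \<open>wb\<close>.
\<close>

locale exponent_monoid =
  fixes M :: "(int, 'n::{finite, linorder}) vec set"
    and weight :: "(int, 'n) vec \<Rightarrow> nat"
  assumes zero_mem: "0 \<in> M"
    and add_mem: "a \<in> M \<Longrightarrow> b \<in> M \<Longrightarrow> a + b \<in> M"
    and weight_add: "a \<in> M \<Longrightarrow> b \<in> M \<Longrightarrow> weight (a + b) = weight a + weight b"
    and weight_eq_0: "a \<in> M \<Longrightarrow> weight a = 0 \<Longrightarrow> a = 0"
    and wb: "wb vars M"
begin

lemma supported_1: "1 \<in> supported M"
  using zero_mem by (simp add: supported_def one_ilaurent.rep_eq)

lemma supported_times: "f \<in> supported M \<Longrightarrow> g \<in> supported M \<Longrightarrow> f * g \<in> supported M"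
  using supported_mult add_mem by blast

lemma coeffs_in_pcompose:
  "coeffs_in (supported M) p \<Longrightarrow> coeffs_in (supported M) q \<Longrightarrow> coeffs_in (supported M) (pcompose p q)"
  by (intro allI coeff_pcompose_semiring_closed) (auto intro: supported_add supported_times)

lemma finite_decompositions: "finite {b \<in> M. a - b \<in> M}"
  by (rule wb_finite[OF wb wb]) auto

lemma decomposition_0: "{b \<in> M. 0 - b \<in> M} = {0}"
proof -
  have "b = 0" if "b \<in> M" "- b \<in> M" for b
  proof -
    have "weight 0 = weight b + weight (- b)" using weight_add[OF that] by simp
    moreover have "weight 0 = 0" using weight_add[OF zero_mem zero_mem] by simp
    ultimately show ?thesis using weight_eq_0 that(1) by simp
  qed
  then show ?thesis using zero_mem by auto
qed

lemma slice_mult: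
  fixes p q :: "('a::comm_ring_1, 'n) ilaurent poly"
  assumes "coeffs_in (supported M) p" "coeffs_in (supported M) q"
  shows "slice a (p * q) = (\<Sum>b | b \<in> M \<and> a - b \<in> M. slice b p * slice (a - b) q)"
proof (rule poly_eqI)
  fix n
  have "ilaurent_coeff (Polynomial.coeff p i * Polynomial.coeff q j) a =
      (\<Sum>b | b \<in> M \<and> a - b \<in> M. ilaurent_coeff (Polynomial.coeff p i) b * ilaurent_coeff (Polynomial.coeff q j) (a - b))"
    for i j
    using assms finite_decompositions[of a]
    by (intro ilaurent_coeff_times_superset) (auto simp: supported_def)
  then have "Polynomial.coeff (slice a (p * q)) n = (\<Sum>i\<le>n. \<Sum>b | b \<in> M \<and> a - b \<in> M.
      ilaurent_coeff (Polynomial.coeff p i) b * ilaurent_coeff (Polynomial.coeff q (n - i)) (a - b))"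
    by (simp add: coeff_mult ilaurent_coeff_sum)
  then show "Polynomial.coeff (slice a (p * q)) n =
      Polynomial.coeff (\<Sum>b | b \<in> M \<and> a - b \<in> M. slice b p * slice (a - b) q) n"
    by (simp add: Polynomial.coeff_sum coeff_mult sum.swap[of _ "{..n}"])
qed

lemma ex_poly_with_slices:
  fixes G :: "(int, 'n) vec \<Rightarrow> 'a::comm_ring_1 poly"
  assumes "\<And>a. a \<notin> M \<Longrightarrow> G a = 0" "\<And>a. Polynomial.degree (G a) \<le> n"
  obtains p where "coeffs_in (supported M) p" "\<And>a. slice a p = G a"
proof -
  define F where "F j = Abs_ilaurent (\<lambda>a. Polynomial.coeff (G a) j)" for j
  have F: "ilaurent_coeff (F j) a = Polynomial.coeff (G a) j" for j a
  proof -
    have "wb vars {a. Polynomial.coeff (G a) j \<noteq> 0}"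
      by (rule wb_mono[OF wb]) (use assms(1) in force)
    then show ?thesis unfolding F_def by (simp add: Abs_ilaurent_inverse iter_laurent_vars_iff)
  qed
  have F0: "F j = 0" if "n < j" for j
    by (rule ilaurent_eqI) (use F assms(2) that in \<open>auto simp: zero_ilaurent.rep_eq intro!: coeff_eq_0 intro: le_less_trans\<close>)
  define p where "p = (\<Sum>j\<le>n. Polynomial.monom (F j) j)"
  have p: "Polynomial.coeff p i = F i" for i
    unfolding p_def using F0 by (auto simp: Polynomial.coeff_sum)
  have "coeffs_in (supported M) p"
    unfolding p supported_def using F assms(1) by force
  moreover have "slice a p = G a" for a
    by (rule poly_eqI) (simp add: p F)
  ultimately show thesis by (rule that)
qed

end

text \<open>
  Modulo a coprime pair of polynomials every right hand side of small degree can be solved for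
  with the degrees that the corrections in Hensel's lemma need.
\<close>

lemma bezout_solve:
  fixes p q x y r :: "'a::field poly"
  assumes bez: "x * p + y * q = 1"
    and "0 < Polynomial.degree p" "0 < Polynomial.degree q"
    and r: "Polynomial.degree r < Polynomial.degree p + Polynomial.degree q"
  obtains u v where "p * v + q * u = r" "Polynomial.degree u < Polynomial.degree p"
    "Polynomial.degree v < Polynomial.degree q"
proof -
  define u where "u = (y * r) mod p"
  have u: "Polynomial.degree u < Polynomial.degree p"
    unfolding u_def using assms(2) degree_mod_less[of p "y * r"] by force
  have "p dvd r - q * u"
  proof -
    have "r - q * u = (x * p + y * q) * r - q * u" using bez by simp
    also have "\<dots> = p * (x * r) + q * (y * r - u)" by (simp add: algebra_simps)
    also have "y * r - u = p * ((y * r) div p)" unfolding u_def by (simp add: minus_mod_eq_mult_div)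
    finally have "r - q * u = p * (x * r + q * ((y * r) div p))" by (simp add: algebra_simps)
    then show ?thesis by simp
  qed
  then obtain v where v: "r - q * u = p * v" by (elim dvdE)
  have "Polynomial.degree v < Polynomial.degree q"
  proof (cases "v = 0")
    case False
    then have "Polynomial.degree p + Polynomial.degree v = Polynomial.degree (r - q * u)"
      unfolding v using assms(2) by (subst degree_mult_eq) auto
    also have "\<dots> < Polynomial.degree p + Polynomial.degree q"
    proof (rule degree_diff_less[OF r])
      show "Polynomial.degree (q * u) < Polynomial.degree p + Polynomial.degree q"
        using degree_mult_le[of q u] u by linarith
    qed
    finally show ?thesis by simp
  qed (use assms in auto)
  then show thesis using that[of v u] v u by (simp add: algebra_simps)
qed

text \<open>
  Comparing coefficients at the exponent \<open>a\<close>, the equation \<open>P = p q\<close> says that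
  \<open>p_0 q_a + q_0 p_a\<close> equals \<open>P_a\<close> minus the sum of the products \<open>p_b q_(a-b)\<close> with \<open>b\<close> and \<open>a - b\<close> nonzero, of smaller
  weight. So \<open>p_a\<close> and \<open>q_a\<close> can be found recursively by \<open>bezout_solve\<close>. As \<open>P\<close> is monic, its slices
  at nonzero exponents have smaller degree than \<open>P\<close>, which keeps the degrees of all corrections
  below those of \<open>p_0\<close> and \<open>q_0\<close>.
\<close>

lemma (in exponent_monoid) hensel_factorization:
  fixes P :: "('a::field, 'n) ilaurent poly"
  assumes P: "Polynomial.lead_coeff P = 1" "coeffs_in (supported M) P"
    and split: "slice 0 P = p0 * q0"
    and monic: "Polynomial.lead_coeff p0 = 1" "Polynomial.lead_coeff q0 = 1"
    and deg: "0 < Polynomial.degree p0" "0 < Polynomial.degree q0"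
    and bez: "x * p0 + y * q0 = 1"
  obtains p q where "P = p * q" "coeffs_in (supported M) p" "coeffs_in (supported M) q"
    "Polynomial.lead_coeff p = 1" "Polynomial.lead_coeff q = 1"
    "Polynomial.degree p = Polynomial.degree p0" "Polynomial.degree q = Polynomial.degree q0"
proof -
  have degP: "Polynomial.degree P = Polynomial.degree p0 + Polynomial.degree q0"
  proof -
    have "Polynomial.degree P = Polynomial.degree (p0 * q0)"
      using slice_0_monic(1)[OF P(1)] split by simp
    also have "\<dots> = Polynomial.degree p0 + Polynomial.degree q0"
      using deg by (intro degree_mult_eq) auto
    finally show ?thesis .
  qed
  define rhs where "rhs f a = slice a P - (\<Sum>b\<in>{b \<in> M. a - b \<in> M} - {0, a}. fst (f b) * snd (f (a - b)))"
    for f :: "(int, 'n) vec \<Rightarrow> 'a poly \<times> 'a poly" and a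
  \<comment> \<open>\<open>r\<close> is an admissible pair of slices of the factors at \<open>a\<close> if \<open>f\<close> has them at smaller weights\<close>
  define Q where "Q f a r \<longleftrightarrow> (if a \<notin> M then r = (0, 0) else if a = 0 then r = (p0, q0)
      else p0 * snd r + q0 * fst r = rhs f a \<and> Polynomial.degree (fst r) < Polynomial.degree p0
        \<and> Polynomial.degree (snd r) < Polynomial.degree q0)"
    for f :: "(int, 'n) vec \<Rightarrow> 'a poly \<times> 'a poly" and a r
  let ?R = "{(b, a). b \<in> M \<and> a \<in> M \<and> weight b < weight a}"
  have smaller: "(b, a) \<in> ?R" "(a - b, a) \<in> ?R" if "b \<in> {b \<in> M. a - b \<in> M} - {0, a}" for a b
  proof -
    have b: "b \<in> M" "a - b \<in> M" "b \<noteq> 0" "a - b \<noteq> 0" using that by auto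
    have "weight a = weight b + weight (a - b)" using weight_add[OF b(1,2)] by simp
    moreover have "weight b \<noteq> 0" "weight (a - b) \<noteq> 0" using weight_eq_0[OF b(1)] weight_eq_0[OF b(2)] b(3,4) by blast+
    moreover have "a \<in> M" using add_mem[OF b(1,2)] by simp
    ultimately show "(b, a) \<in> ?R" "(a - b, a) \<in> ?R" using b by auto
  qed
  have "\<exists>f. \<forall>a. Q f a (f a)"
  proof (rule dependent_wf_choice)
    show "wf ?R" by (rule wf_subset[OF wf_measure[of weight]]) auto
    show "Q f a r = Q g a r" if eq: "\<And>z. (z, a) \<in> ?R \<Longrightarrow> f z = g z" for f g a r
    proof -
      have "rhs f a = rhs g a"
        unfolding rhs_def using eq[OF smaller(1)] eq[OF smaller(2)] by (metis (no_types, lifting) sum.cong)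
      then show ?thesis unfolding Q_def by simp
    qed
    show "\<exists>r. Q f a r" if IH: "\<And>b. (b, a) \<in> ?R \<Longrightarrow> Q f b (f b)" for a f
    proof (cases "a \<in> M \<and> a \<noteq> 0")
      case True
      have "Polynomial.degree (rhs f a) < Polynomial.degree p0 + Polynomial.degree q0"
        unfolding rhs_def
      proof (rule degree_diff_less)
        show "Polynomial.degree (slice a P) < Polynomial.degree p0 + Polynomial.degree q0"
          using degree_slice_less[OF P(1), of a] True deg degP by simp
        have "Polynomial.degree (fst (f b) * snd (f (a - b))) < Polynomial.degree p0 + Polynomial.degree q0"
          if b: "b \<in> {b \<in> M. a - b \<in> M} - {0, a}" for b
        proof -
          have "Polynomial.degree (fst (f b)) < Polynomial.degree p0"
            "Polynomial.degree (snd (f (a - b))) < Polynomial.degree q0"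
            using IH[OF smaller(1)[OF b]] IH[OF smaller(2)[OF b]] b unfolding Q_def by auto
          then show ?thesis using degree_mult_le[of "fst (f b)" "snd (f (a - b))"] by linarith
        qed
        then show "Polynomial.degree (\<Sum>b\<in>{b \<in> M. a - b \<in> M} - {0, a}. fst (f b) * snd (f (a - b)))
            < Polynomial.degree p0 + Polynomial.degree q0"
          using deg by (intro degree_sum_less) auto
      qed
      then obtain u v where "p0 * v + q0 * u = rhs f a" "Polynomial.degree u < Polynomial.degree p0"
        "Polynomial.degree v < Polynomial.degree q0"
        using bezout_solve[OF bez deg] by blast
      then have "Q f a (u, v)" using True unfolding Q_def by simp
      then show ?thesis by blast
    qed (auto simp: Q_def)
  qed
  then obtain f where f: "\<And>a. Q f a (f a)" by blast
  have f0: "f 0 = (p0, q0)" using f[of 0] zero_mem unfolding Q_def by simp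
  have notin: "f a = (0, 0)" if "a \<notin> M" for a using f[of a] that unfolding Q_def by simp
  have less: "Polynomial.degree (fst (f a)) < Polynomial.degree p0"
    "Polynomial.degree (snd (f a)) < Polynomial.degree q0" if "a \<noteq> 0" for a
    using f[of a] that deg unfolding Q_def by (cases "a \<in> M"; simp)+
  have le: "Polynomial.degree (fst (f a)) \<le> Polynomial.degree p0"
    "Polynomial.degree (snd (f a)) \<le> Polynomial.degree q0" for a
    using less[of a] f0 by (cases "a = 0"; simp)+
  obtain p where p: "coeffs_in (supported M) p" "\<And>a. slice a p = fst (f a)"
    by (rule ex_poly_with_slices[of "\<lambda>a. fst (f a)"]) (use notin le in auto)
  obtain q where q: "coeffs_in (supported M) q" "\<And>a. slice a q = snd (f a)"
    by (rule ex_poly_with_slices[of "\<lambda>a. snd (f a)"]) (use notin le in auto)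
  have monic_lift: "Polynomial.degree r = Polynomial.degree r0 \<and> Polynomial.lead_coeff r = 1"
    if r0: "slice 0 r = r0" "Polynomial.lead_coeff r0 = 1"
    and less: "\<And>a. a \<noteq> 0 \<Longrightarrow> Polynomial.degree (slice a r) < Polynomial.degree r0"
    for r :: "('a, 'n) ilaurent poly" and r0
  proof -
    have "Polynomial.degree (slice a r) \<le> Polynomial.degree r0" for a
      using less[of a] r0 by (cases "a = 0") auto
    then have "Polynomial.coeff (slice a r) i = 0" if "Polynomial.degree r0 < i" for a i
      using that le_less_trans by (intro coeff_eq_0) blast
    then have "Polynomial.coeff r i = 0" if "Polynomial.degree r0 < i" for i
      using that by (intro ilaurent_eqI) (simp add: zero_ilaurent.rep_eq)
    then have "Polynomial.degree r \<le> Polynomial.degree r0" by (intro degree_le) auto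
    moreover have c: "Polynomial.coeff r (Polynomial.degree r0) = 1"
    proof (rule ilaurent_eqI)
      fix a
      show "ilaurent_coeff (Polynomial.coeff r (Polynomial.degree r0)) a = ilaurent_coeff 1 a"
        using r0 coeff_eq_0[OF less[of a]] by (cases "a = 0") (auto simp: one_ilaurent.rep_eq)
    qed
    then have "Polynomial.degree r0 \<le> Polynomial.degree r" by (intro le_degree) auto
    ultimately have "Polynomial.degree r = Polynomial.degree r0" by simp
    then show ?thesis using c by simp
  qed
  have pq: "Polynomial.degree p = Polynomial.degree p0 \<and> Polynomial.lead_coeff p = 1"
    "Polynomial.degree q = Polynomial.degree q0 \<and> Polynomial.lead_coeff q = 1"
    by (rule monic_lift; use p q f0 monic less in auto)+
  have "P = p * q"
  proof (rule poly_eq_slices)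
    fix a
    have "slice a (p * q) = (\<Sum>b\<in>{b \<in> M. a - b \<in> M}. fst (f b) * snd (f (a - b)))"
      using slice_mult[OF p(1) q(1)] p(2) q(2) by simp
    also have "\<dots> = slice a P"
    proof (cases "a \<in> M")
      case False
      have "a \<in> M" if "b \<in> M" "a - b \<in> M" for b using add_mem[OF that] by simp
      then have none: "{b \<in> M. a - b \<in> M} = {}" using False by blast
      then show ?thesis unfolding none using slice_eq_0[OF P(2) False] by simp
    next
      case a: True
      show ?thesis
      proof (cases "a = 0")
        case True
        have "{b \<in> M. a - b \<in> M} = {0}" using decomposition_0 True by simp
        then show ?thesis using True f0 split by simp
      next
        case False
        let ?S = "{b \<in> M. a - b \<in> M} - {0, a}"
        have "{b \<in> M. a - b \<in> M} = insert 0 (insert a ?S)"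
          using a zero_mem by auto
        moreover have "finite ?S" using finite_decompositions[of a] by simp
        moreover have "0 \<notin> insert a ?S" "a \<notin> ?S" using False by auto
        ultimately have "(\<Sum>b\<in>{b \<in> M. a - b \<in> M}. fst (f b) * snd (f (a - b))) =
            fst (f 0) * snd (f (a - 0)) + (fst (f a) * snd (f (a - a))
            + (\<Sum>b\<in>?S. fst (f b) * snd (f (a - b))))"
          by (metis (no_types, lifting) finite_insert sum.insert)
        also have "\<dots> = slice a P"
          using f[of a] a False f0 unfolding Q_def rhs_def by (simp add: algebra_simps)
        finally show ?thesis .
      qed
    qed
    finally show "slice a P = slice a (p * q)" by simp
  qed
  then show thesis using that p(1) q(1) pq by blast
qed

section \<open>Splitting the residue polynomial\<close>

text \<open>
  Coprimality is produced directly as a Bezout identity: \<open>q\<close> is invertible modulo \<open>z - \<alpha>\<close> by the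
  inverse of its value, and \<open>1 - (1 - c q)^r\<close> is a multiple of \<open>q\<close>.
\<close>

lemma bezout_root_power:
  fixes q :: "'a::field poly"
  assumes "poly q \<alpha> \<noteq> 0"
  obtains x y where "x * [:- \<alpha>, 1:] ^ r + y * q = 1"
proof -
  define c where "c = [:inverse (poly q \<alpha>):]"
  have "poly (1 - c * q) \<alpha> = 0" using assms by (simp add: c_def)
  then obtain t where t: "1 - c * q = [:- \<alpha>, 1:] * t" 
    unfolding poly_eq_0_iff_dvd by (rule dvdE)
  have "(1 - c * q) ^ r = t ^ r * [:- \<alpha>, 1:] ^ r"
    by (simp only: t power_mult_distrib mult.commute)
  moreover have "1 - (1 - c * q) ^ r = c * q * (\<Sum>i<r. (1 - c * q) ^ i)"
    using one_diff_power_eq[of "1 - c * q" r] by simp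
  ultimately have "t ^ r * [:- \<alpha>, 1:] ^ r + (c * (\<Sum>i<r. (1 - c * q) ^ i)) * q = 1"
    by (metis (no_types, lifting) add.commute diff_add_cancel mult.assoc mult.commute)
  then show thesis by (rule that)
qed

text \<open>
  Split off the full power of \<open>z - \<alpha>\<close> for a root \<open>\<alpha>\<close>. If nothing were left, the polynomial would be
  \<open>(z - \<alpha>)^r\<close>, whose coefficient \<open>- r \<alpha>\<close> in degree \<open>r - 1\<close> vanishes only for \<open>\<alpha> = 0\<close> in characteristic
  zero.
\<close>

lemma coprime_factors_of_depressed:
  fixes p :: "'a::{alg_closed_field, field_char_0} poly"
  assumes monic: "Polynomial.lead_coeff p = 1" and pos: "0 < Polynomial.degree p"
    and depressed: "Polynomial.coeff p (Polynomial.degree p - 1) = 0"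
    and nontrivial: "p \<noteq> Polynomial.monom 1 (Polynomial.degree p)"
  obtains p0 q0 x y where "p = p0 * q0" "Polynomial.lead_coeff p0 = 1" "Polynomial.lead_coeff q0 = 1"
    "0 < Polynomial.degree p0" "0 < Polynomial.degree q0" "x * p0 + y * q0 = 1"
proof -
  obtain \<alpha> where root: "poly p \<alpha> = 0" using alg_closed_imp_poly_has_root[OF pos] by blast
  have "p \<noteq> 0" using pos by auto
  define r where "r = Polynomial.order \<alpha> p"
  obtain q where q: "p = [:- \<alpha>, 1:] ^ r * q" "\<not> [:- \<alpha>, 1:] dvd q"
    using order_decomp[OF \<open>p \<noteq> 0\<close>] unfolding r_def by blast
  have r: "0 < r" using root \<open>p \<noteq> 0\<close> unfolding r_def by (simp add: order_root)
  have q_monic: "Polynomial.lead_coeff q = 1"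
    using monic unfolding q(1) lead_coeff_mult by (simp add: lead_coeff_power)
  have deg: "Polynomial.degree p = r + Polynomial.degree q"
    using q_monic by (subst q(1), subst degree_mult_eq) (auto simp: degree_linear_power)
  have "0 < Polynomial.degree q"
  proof (rule ccontr)
    assume "\<not> 0 < Polynomial.degree q"
    then have "q = 1" using q_monic by (auto elim!: degree_eq_zeroE)
    then have p: "p = [:- \<alpha>, 1:] ^ r" and "Polynomial.degree p = r" using q(1) deg by simp_all
    obtain k where k: "r = Suc k" using r by (cases r) auto
    have "of_nat (Suc k) * (- \<alpha>) = 0"
      using depressed coeff_linear_poly_power[of k r "- \<alpha>" 1] unfolding \<open>Polynomial.degree p = r\<close>
      by (simp add: p k del: of_nat_Suc power_Suc)
    then have "\<alpha> = 0" using of_nat_neq_0[of k, where ?'a = 'a] by simp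
    then show False using nontrivial p \<open>Polynomial.degree p = r\<close> by (simp add: monom_altdef)
  qed
  moreover obtain x y where "x * [:- \<alpha>, 1:] ^ r + y * q = 1"
    using bezout_root_power q(2) poly_eq_0_iff_dvd by metis
  moreover have "Polynomial.lead_coeff ([:- \<alpha>, 1:] ^ r) = 1" by (simp add: lead_coeff_power)
  ultimately show thesis using that[OF q(1)] q_monic r by (auto simp: degree_linear_power)
qed

section \<open>Substitutions in split polynomials\<close>

definition linear_product :: "'a::comm_ring_1 list \<Rightarrow> 'a poly" where
  "linear_product zs = (\<Prod>z\<leftarrow>zs. [:- z, 1:])"

lemma linear_product_simps [simp]:
  "linear_product [] = 1"
  "linear_product (z # zs) = [:- z, 1:] * linear_product zs"
  "linear_product (xs @ ys) = linear_product xs * linear_product ys"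
  by (simp_all add: linear_product_def)

lemma degree_linear_product: "Polynomial.degree (linear_product (zs :: 'a::idom list)) = length zs"
proof -
  have "Polynomial.degree (linear_product zs) = length zs \<and> linear_product zs \<noteq> 0"
    by (induction zs) (auto simp: degree_mult_eq simp del: mult_pCons_left)
  then show ?thesis ..
qed

lemma linear_product_replicate_0: "linear_product (replicate m 0) = Polynomial.monom 1 m"
  by (induction m) (auto simp: monom_Suc)

lemma linear_product_shift:
  "pcompose (linear_product zs) [:c, 1:] = linear_product (map (\<lambda>z. z - c) zs)"
  by (induction zs) (auto simp: pcompose_mult pcompose_pCons pcompose_1 simp del: mult_pCons_left)

lemma linear_product_scale:
  fixes s t :: "'a::comm_ring_1"
  assumes "s * t = 1"
  shows "Polynomial.smult (t ^ length zs) (pcompose (linear_product zs) [:0, s:]) =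
    linear_product (map (\<lambda>z. t * z) zs)"
proof (induction zs)
  case (Cons z zs)
  have "Polynomial.smult t (pcompose [:- z, 1:] [:0, s:]) = [:- (t * z), 1:]"
    using assms by (simp add: pcompose_pCons mult.commute)
  then show ?case
    using Cons by (simp add: pcompose_mult smult_smult[symmetric] mult_smult_left[symmetric] mult_smult_right[symmetric]
      del: mult_pCons_left smult_smult mult_smult_left mult_smult_right)
      (metis mult_smult_left mult_smult_right smult_smult)
qed (simp add: pcompose_1)

lemma pcompose_monom: "pcompose (Polynomial.monom 1 m) q = (q::'a::comm_semiring_1 poly) ^ m"
  by (induction m) (auto simp: monom_Suc pcompose_pCons pcompose_1)

lemma coeff_pcompose_shift:
  fixes p :: "'a::idom poly"
  assumes monic: "Polynomial.lead_coeff p = 1" and deg: "Polynomial.degree p = Suc k"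
  shows "Polynomial.coeff (pcompose p [:c, 1:]) k = Polynomial.coeff p k + of_nat (Suc k) * c"
proof -
  define r where "r = p - Polynomial.monom 1 (Suc k)"
  have r: "Polynomial.degree r \<le> k"
  proof (rule degree_le, intro allI impI)
    fix i assume "k < i"
    then show "Polynomial.coeff r i = 0"
      using monic deg by (cases "i = Suc k") (auto simp: r_def coeff_eq_0)
  qed
  have "Polynomial.degree (pcompose r [:c, 1:]) = Polynomial.degree r" by (simp add: degree_pcompose)
  moreover have "Polynomial.lead_coeff (pcompose r [:c, 1:]) = Polynomial.lead_coeff r"
    by (simp add: lead_coeff_comp)
  ultimately have "Polynomial.coeff (pcompose r [:c, 1:]) k = Polynomial.coeff r k"
    using r by (cases "Polynomial.degree r = k") (auto simp: coeff_eq_0)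
  moreover have "p = r + Polynomial.monom 1 (Suc k)" by (simp add: r_def)
  ultimately have "Polynomial.coeff (pcompose p [:c, 1:]) k =
      Polynomial.coeff r k + Polynomial.coeff ([:c, 1:] ^ Suc k) k"
    by (simp only: pcompose_add pcompose_monom coeff_add)
  also have "Polynomial.coeff ([:c, 1:] ^ Suc k) k = of_nat (Suc k) * c"
    by (subst coeff_linear_poly_power) auto
  also have "Polynomial.coeff r k = Polynomial.coeff p k" by (simp add: r_def)
  finally show ?thesis .
qed

section \<open>Newton--Puiseux by induction on the degree\<close>

definition tilted_lattice :: "nat \<Rightarrow> nat \<Rightarrow> (int, 'n::{finite, linorder}) vec set" where
  "tilted_lattice N e = {a \<in> tilted_orthant N. \<forall>l. int e dvd a $ l}"

lemma tilted_lattice_subset: "tilted_lattice N e \<subseteq> tilted_orthant N"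
  by (auto simp: tilted_lattice_def)

lemma supported_tilted_orthant_mono:
  "f \<in> supported (tilted_orthant N) \<Longrightarrow> N \<le> N' \<Longrightarrow> f \<in> supported (tilted_orthant N')"
  using supported_mono[OF tilted_orthant_mono] by blast

lemma exponent_monoid_tilted_lattice:
  "exponent_monoid (tilted_lattice N e :: (int, 'b::{finite, linorder}) vec set) (\<lambda>a. nat (\<Sum>l\<in>UNIV. tilt N a l))"
proof
  fix a b :: "(int, 'b::{finite, linorder}) vec"
  assume a: "a \<in> tilted_lattice N e"
  then have nonneg: "0 \<le> tilt N a l" for l by (simp add: tilted_lattice_def tilted_orthant_def)
  then have nn: "0 \<le> (\<Sum>l\<in>UNIV. tilt N a l)" by (simp add: sum_nonneg)
  show "a = 0" if "nat (\<Sum>l\<in>UNIV. tilt N a l) = 0"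
  proof (rule tilt_eq_0_imp)
    have "(\<Sum>l\<in>UNIV. tilt N a l) = 0" using that nn by simp
    then show "tilt N a l = 0" for l using nonneg by (simp add: sum_nonneg_eq_0_iff)
  qed
  assume b: "b \<in> tilted_lattice N e"
  then have "0 \<le> (\<Sum>l\<in>UNIV. tilt N b l)"
    by (intro sum_nonneg) (simp add: tilted_lattice_def tilted_orthant_def)
  then show "nat (\<Sum>l\<in>UNIV. tilt N (a + b) l) = nat (\<Sum>l\<in>UNIV. tilt N a l) + nat (\<Sum>l\<in>UNIV. tilt N b l)"
    using nn by (simp add: tilt_add sum.distrib nat_add_distrib)
  show "a + b \<in> tilted_lattice N e"
    using a b by (auto simp: tilted_lattice_def intro: tilted_orthant_add)
next
  show "wb vars (tilted_lattice N e :: (int, 'b::{finite, linorder}) vec set)"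
    by (rule wb_mono[OF wb_tilted_orthant]) (auto simp: tilted_lattice_def)
qed (simp add: tilted_lattice_def)

text \<open>
  The slope \<open>\<gamma>\<close> is the lexicographic minimum of \<open>a / (m - j)\<close> over the exponents \<open>a\<close> of the
  coefficient of \<open>z^j\<close> with \<open>j < m\<close>. All these are multiplied by \<open>m!\<close> so that they can be compared as integral
  vectors, and \<open>tilted_orthant_dominant\<close> is applied once to the set of all of them. The factor
  \<open>m!\<close> in the lattice makes \<open>\<gamma>\<close>, and with it the new exponents, divisible by \<open>e\<close>.
\<close>

lemma newton_slope:
  fixes Q :: "('a::idom, 'n::{finite, linorder}) ilaurent poly"
  assumes coeffs: "coeffs_in (supported (tilted_lattice N (fact m * e))) Q"
    and ex: "\<exists>j<m. Polynomial.coeff Q j \<noteq> 0"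
  obtains \<gamma> N' j0 where "N \<le> N'" "\<gamma> \<in> tilted_orthant N" "j0 < m"
    "ilaurent_coeff (Polynomial.coeff Q j0) (int (m - j0) *s \<gamma>) \<noteq> 0"
    "\<And>j. j < m \<Longrightarrow> laurent_monom 1 (- (int (m - j) *s \<gamma>)) * Polynomial.coeff Q j \<in> supported (tilted_lattice N' e)"
proof -
  let ?c = "\<lambda>j. ilaurent_coeff (Polynomial.coeff Q j)"
  define k where "k j = int (fact m div (m - j))" for j
  have k: "int (m - j) * k j = fact m" "0 < k j" if "j < m" for j
  proof -
    have "m - j dvd fact m" using that by (intro dvd_fact) auto
    then have "(m - j) * (fact m div (m - j)) = fact m" by (rule dvd_mult_div_cancel)
    then show *: "int (m - j) * k j = fact m"
      unfolding k_def by (metis of_nat_fact of_nat_mult)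
    have "(0::int) < fact m" by simp
    then show "0 < k j" using that by (simp flip: * add: zero_less_mult_iff)
  qed
  have supp: "a \<in> tilted_orthant N" "int (fact m * e) dvd a $ l" if "?c j a \<noteq> 0" for a j l
    using coeffs that by (auto simp: supported_def tilted_lattice_def)
  \<comment> \<open>\<open>k j *s a\<close> is \<open>m!\<close> times the slope \<open>a / (m - j)\<close>\<close>
  define S where "S = {k j *s a | j a. j < m \<and> ?c j a \<noteq> 0}"
  have S: "S \<subseteq> tilted_orthant N"
    using supp(1) k(2) by (auto simp: S_def tilted_orthant_smult_iff)
  have "S \<noteq> {}"
  proof -
    obtain j where "j < m" "Polynomial.coeff Q j \<noteq> 0" using ex by blast
    moreover from this obtain a where "?c j a \<noteq> 0"
      using ilaurent_eqI[of "Polynomial.coeff Q j" 0] by (auto simp: zero_ilaurent.rep_eq)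
    ultimately show ?thesis by (auto simp: S_def)
  qed
  then obtain \<mu> N' where \<mu>: "\<mu> \<in> S" "N \<le> N'" "\<And>b. b \<in> S \<Longrightarrow> b - \<mu> \<in> tilted_orthant N'"
    using tilted_orthant_dominant[OF S] by metis
  then obtain j0 a0 where j0: "\<mu> = k j0 *s a0" "j0 < m" "?c j0 a0 \<noteq> 0" by (auto simp: S_def)
  \<comment> \<open>this is \<open>a0 / (m - j0)\<close>, written so as to be integral: \<open>m!\<close> divides \<open>a0\<close>\<close>
  define \<gamma> where "\<gamma> = k j0 *s (\<chi> l. a0 $ l div fact m)"
  have dvd0: "(fact m :: int) dvd a0 $ l" for l
    using supp(2)[OF j0(3), of l] by (auto dest: dvd_mult_left)
  have slope: "int (m - j0) *s \<gamma> = a0"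
  proof -
    have "(int (m - j0) *s \<gamma>) $ l = a0 $ l" for l
    proof -
      have "(int (m - j0) *s \<gamma>) $ l = int (m - j0) * k j0 * (a0 $ l div fact m)"
        by (simp only: \<gamma>_def vector_smult_component vec_lambda_beta mult.assoc)
      then show ?thesis using k(1)[OF j0(2)] dvd0[of l] by simp
    qed
    then show ?thesis by (simp add: vec_eq_iff)
  qed
  have \<gamma>\<mu>: "(k j * int (m - j)) *s \<gamma> = \<mu>" if "j < m" for j
  proof -
    have "(k j * int (m - j)) *s \<gamma> = (k j0 * int (m - j0)) *s \<gamma>"
      using k(1)[OF that] k(1)[OF j0(2)] by (simp add: mult.commute)
    also have "\<dots> = k j0 *s (int (m - j0) *s \<gamma>)" by (simp add: vec_eq_iff)
    finally show ?thesis by (simp only: slope j0(1))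
  qed
  have \<gamma>_lattice: "int e dvd \<gamma> $ l" for l
  proof -
    have "fact m * int e dvd fact m * (a0 $ l div fact m)"
      using supp(2)[OF j0(3), of l] dvd0[of l] by simp
    then have "int e dvd a0 $ l div fact m" by simp
    then show ?thesis by (simp add: \<gamma>_def)
  qed
  have "\<gamma> \<in> tilted_orthant N"
    using \<mu>(1) S \<gamma>\<mu>[OF j0(2)] k[OF j0(2)]
    by (metis fact_gt_zero mult.commute subsetD tilted_orthant_smult_iff)
  moreover have "laurent_monom 1 (- (int (m - j) *s \<gamma>)) * Polynomial.coeff Q j \<in> supported (tilted_lattice N' e)"
    if j: "j < m" for j
    unfolding supported_def
  proof (intro CollectI allI impI)
    fix b assume "ilaurent_coeff (laurent_monom 1 (- (int (m - j) *s \<gamma>)) * Polynomial.coeff Q j) b \<noteq> 0"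
    then have a: "?c j (b + int (m - j) *s \<gamma>) \<noteq> 0" by simp
    then have "k j *s (b + int (m - j) *s \<gamma>) - \<mu> \<in> tilted_orthant N'"
      unfolding S_def using j by (intro \<mu>(3)[unfolded S_def]) blast
    moreover have "k j *s (b + int (m - j) *s \<gamma>) - \<mu> = k j *s b"
      by (subst \<gamma>\<mu>[OF j, symmetric]) (simp add: vec_eq_iff algebra_simps)
    ultimately have "b \<in> tilted_orthant N'" using k(2)[OF j] by (simp add: tilted_orthant_smult_iff)
    moreover have "int e dvd b $ l" for l
    proof -
      have "int e dvd b $ l + int (m - j) * \<gamma> $ l"
        using supp(2)[OF a, of l] by (auto dest: dvd_mult_right)
      then show ?thesis using \<gamma>_lattice[of l] by (simp add: dvd_add_left_iff)
    qed
    ultimately show "b \<in> tilted_lattice N' e" by (simp add: tilted_lattice_def)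
  qed
  ultimately show thesis using that[of N' \<gamma> j0] \<mu>(2) j0 slope by simp
qed

text \<open>
  Forming a slope in degree \<open>m\<close> uses up one factor \<open>m!\<close>, after which only smaller degrees occur.
\<close>

definition puiseux_denominator :: "nat \<Rightarrow> nat" where
  "puiseux_denominator m = (\<Prod>i\<le>m. fact i)"

lemma puiseux_denominator_dvd: "fact m * puiseux_denominator r dvd puiseux_denominator m" if "r < m"
proof -
  obtain k where k: "m = Suc k" using \<open>r < m\<close> by (cases m) auto
  have "puiseux_denominator r dvd puiseux_denominator k"
    unfolding puiseux_denominator_def using that k by (intro prod_dvd_prod_subset) auto
  then show ?thesis by (simp add: k puiseux_denominator_def mult.commute del: fact_Suc)
qed

definition splits_tilted :: "('a::comm_ring_1, 'n::{finite, linorder}) ilaurent poly \<Rightarrow> bool" where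
  "splits_tilted P \<longleftrightarrow> (\<exists>N zs. P = linear_product zs \<and> set zs \<subseteq> supported (tilted_orthant N))"

lemma splits_tilted_mult: "splits_tilted p \<Longrightarrow> splits_tilted q \<Longrightarrow> splits_tilted (p * q)"
proof -
  assume "splits_tilted p" "splits_tilted q"
  then obtain N zs N' zs' where z: "p = linear_product zs" "set zs \<subseteq> supported (tilted_orthant N)"
    "q = linear_product zs'" "set zs' \<subseteq> supported (tilted_orthant N')"
    unfolding splits_tilted_def by blast
  then have "set (zs @ zs') \<subseteq> supported (tilted_orthant (max N N'))"
    using supported_tilted_orthant_mono[of _ N "max N N'"] supported_tilted_orthant_mono[of _ N' "max N N'"]
    by auto
  then show ?thesis unfolding splits_tilted_def using z by (metis linear_product_simps(3))
qed

lemma splits_tilted_shift: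
  assumes "splits_tilted (pcompose P [:c, 1:])" "c \<in> supported (tilted_orthant N)"
  shows "splits_tilted P"
proof -
  obtain N' zs where z: "pcompose P [:c, 1:] = linear_product zs" "set zs \<subseteq> supported (tilted_orthant N')"
    using assms(1) unfolding splits_tilted_def by blast
  have "P = pcompose (pcompose P [:c, 1:]) [:- c, 1:]"
    by (simp add: pcompose_assoc[symmetric] pcompose_pCons)
  also have "\<dots> = linear_product (map (\<lambda>z. z - - c) zs)" unfolding z(1) by (rule linear_product_shift)
  finally have "P = linear_product (map (\<lambda>z. z + c) zs)" by simp
  moreover have "set (map (\<lambda>z. z + c) zs) \<subseteq> supported (tilted_orthant (max N N'))"
    using z(2) assms(2) supported_tilted_orthant_mono[of _ N "max N N'"]
      supported_tilted_orthant_mono[of _ N' "max N N'"]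
    by (auto intro!: supported_add)
  ultimately show ?thesis unfolding splits_tilted_def by blast
qed

lemma splits_tilted_scale:
  fixes P :: "('a::idom, 'n::{finite, linorder}) ilaurent poly"
  assumes "splits_tilted (Polynomial.smult (laurent_monom 1 (- \<gamma>) ^ Polynomial.degree P)
      (pcompose P [:0, laurent_monom 1 \<gamma>:]))"
    and \<gamma>: "\<gamma> \<in> tilted_orthant N"
  shows "splits_tilted P"
proof -
  define s t :: "('a, 'n) ilaurent" where "s = laurent_monom 1 (- \<gamma>)" and "t = laurent_monom 1 \<gamma>"
  define m where "m = Polynomial.degree P"
  have st: "s * t = 1" unfolding s_def t_def by (simp add: laurent_monom_mult laurent_monom_0)
  then have pow: "t ^ m * s ^ m = 1" by (metis mult.commute power_mult_distrib power_one)
  define P' where "P' = Polynomial.smult (s ^ m) (pcompose P [:0, t:])"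
  obtain N' zs where z: "P' = linear_product zs" "set zs \<subseteq> supported (tilted_orthant N')"
    using assms(1) unfolding splits_tilted_def P'_def s_def t_def m_def by blast
  have "Polynomial.degree P' = m"
    by (simp add: P'_def degree_pcompose m_def s_def t_def laurent_monom_neq_0)
  then have len: "length zs = m" using z(1) degree_linear_product by metis
  have "pcompose P' [:0, s:] = Polynomial.smult (s ^ m) (pcompose P (pcompose [:0, t:] [:0, s:]))"
    by (simp add: P'_def pcompose_smult pcompose_assoc)
  also have "pcompose [:0, t:] [:0, s:] = [:0, 1:]" using st by (simp add: pcompose_pCons mult.commute)
  finally have "Polynomial.smult (t ^ m) (pcompose P' [:0, s:]) = P" using pow by simp
  then have "P = linear_product (map (\<lambda>z. t * z) zs)"
    using linear_product_scale[OF st, of zs] z(1) len by simp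
  moreover have "set (map (\<lambda>z. t * z) zs) \<subseteq> supported (tilted_orthant (max N N'))"
  proof -
    have "t \<in> supported (tilted_orthant (max N N'))"
      unfolding t_def using \<gamma> tilted_orthant_mono[of N "max N N'"] by (intro supported_laurent_monom) auto
    then show ?thesis
      using z(2) supported_tilted_orthant_mono[of _ N' "max N N'"]
      by (auto intro!: supported_mult tilted_orthant_add)
  qed
  ultimately show ?thesis unfolding splits_tilted_def by blast
qed

text \<open>
  The induction step for a polynomial without a term of degree \<open>m - 1\<close>. The induction hypothesis
  must allow all \<open>N'\<close>, because the new coefficients need a more tilted cone than the old ones.
\<close>

lemma splits_tilted_depressed:
  fixes Q :: "('k::{alg_closed_field, field_char_0}, 'n::{finite, linorder}) ilaurent poly"
  assumes monic: "Polynomial.lead_coeff Q = 1" and m: "Polynomial.degree Q = m" "0 < m"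
    and depressed: "Polynomial.coeff Q (m - 1) = 0"
    and coeffs: "coeffs_in (supported (tilted_lattice N (fact m * e))) Q"
    and IH: "\<And>(p :: ('k, 'n) ilaurent poly) N'. Polynomial.degree p < m \<Longrightarrow> Polynomial.lead_coeff p = 1 \<Longrightarrow>
      coeffs_in (supported (tilted_lattice N' e)) p \<Longrightarrow> splits_tilted p"
  shows "splits_tilted Q"
proof (cases "\<exists>j<m. Polynomial.coeff Q j \<noteq> 0")
  case False
  have "Q = Polynomial.monom 1 m"
  proof (rule poly_eqI)
    fix j show "Polynomial.coeff Q j = Polynomial.coeff (Polynomial.monom 1 m) j"
      using False monic m by (cases j m rule: linorder_cases) (auto simp: coeff_eq_0)
  qed
  then have "Q = linear_product (replicate m 0)" by (simp add: linear_product_replicate_0)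
  moreover have "set (replicate m (0 :: ('k, 'n) ilaurent)) \<subseteq> supported (tilted_orthant 0)" by auto
  ultimately show ?thesis unfolding splits_tilted_def by blast
next
  case True
  obtain \<gamma> N' j0 where \<gamma>: "\<gamma> \<in> tilted_orthant N" and j0: "j0 < m"
    "ilaurent_coeff (Polynomial.coeff Q j0) (int (m - j0) *s \<gamma>) \<noteq> 0"
    and supp: "\<And>j. j < m \<Longrightarrow>
      laurent_monom 1 (- (int (m - j) *s \<gamma>)) * Polynomial.coeff Q j \<in> supported (tilted_lattice N' e)"
    by (rule newton_slope[OF coeffs True]) blast
  interpret M: exponent_monoid "tilted_lattice N' e :: (int, 'n) vec set" "\<lambda>a. nat (\<Sum>l\<in>UNIV. tilt N' a l)"
    by (rule exponent_monoid_tilted_lattice)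
  define Q' where "Q' = Polynomial.smult (laurent_monom 1 (- \<gamma>) ^ Polynomial.degree Q) (pcompose Q [:0, laurent_monom 1 \<gamma>:])"
  have coeff: "Polynomial.coeff Q' j = laurent_monom 1 (- (int (m - j) *s \<gamma>)) * Polynomial.coeff Q j"
    if "j \<le> m" for j
  proof -
    have "int m *s (- \<gamma>) + int j *s \<gamma> = - (int (m - j) *s \<gamma>)"
      using that by (simp add: vec_eq_iff of_nat_diff algebra_simps)
    then show ?thesis
      by (simp add: Q'_def m(1) coeff_pcompose_linear laurent_monom_power laurent_monom_mult mult.assoc[symmetric])
  qed
  have deg': "Polynomial.degree Q' = m"
    by (simp add: Q'_def degree_pcompose m laurent_monom_neq_0)
  have monic': "Polynomial.lead_coeff Q' = 1"
    unfolding deg' using coeff[of m] monic m by (simp add: laurent_monom_0)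
  have coeffs': "coeffs_in (supported (tilted_lattice N' e)) Q'"
  proof
    fix j show "Polynomial.coeff Q' j \<in> supported (tilted_lattice N' e)"
      using supp[of j] coeff[of j] monic' deg' M.supported_1
      by (cases j m rule: linorder_cases) (auto simp: coeff_eq_0)
  qed
  have res: "Polynomial.coeff (slice 0 Q') j = ilaurent_coeff (Polynomial.coeff Q j) (int (m - j) *s \<gamma>)"
    if "j \<le> m" for j
    using coeff[OF that] by simp
  have "slice 0 Q' \<noteq> Polynomial.monom 1 m"
  proof
    assume "slice 0 Q' = Polynomial.monom 1 m"
    then have "Polynomial.coeff (slice 0 Q') j0 = 0" using j0(1) by simp
    then show False using res[of j0] j0 by simp
  qed
  moreover have "Polynomial.coeff (slice 0 Q') (m - 1) = 0"
    using res[of "m - 1"] depressed by (simp add: zero_ilaurent.rep_eq)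
  moreover note slice_0_monic[OF monic']
  ultimately obtain p0 q0 x y where pq0: "slice 0 Q' = p0 * q0"
    "Polynomial.lead_coeff p0 = 1" "Polynomial.lead_coeff q0 = 1"
    "0 < Polynomial.degree p0" "0 < Polynomial.degree q0" "x * p0 + y * q0 = 1"
    using coprime_factors_of_depressed[of "slice 0 Q'"] deg' m(2) by metis
  obtain p q where pq: "Q' = p * q"
    "coeffs_in (supported (tilted_lattice N' e)) p" "coeffs_in (supported (tilted_lattice N' e)) q"
    "Polynomial.lead_coeff p = 1" "Polynomial.lead_coeff q = 1"
    "Polynomial.degree p = Polynomial.degree p0" "Polynomial.degree q = Polynomial.degree q0"
    using M.hensel_factorization[OF monic' coeffs' pq0] by blast
  have "m = Polynomial.degree p + Polynomial.degree q"
    using deg' pq(1,4,5) by (subst deg'[symmetric], subst pq(1), subst degree_mult_eq) auto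
  then have "splits_tilted p" "splits_tilted q"
    using pq pq0(4,5) by (auto intro: IH)
  then have "splits_tilted Q'" unfolding pq(1) by (rule splits_tilted_mult)
  then show ?thesis unfolding Q'_def using \<gamma> by (rule splits_tilted_scale)
qed

text \<open>
  It remains to remove the term of degree \<open>m - 1\<close>: the shift by \<open>- w_1 / m\<close> keeps the coefficients in
  the same ring.
\<close>

lemma newton_puiseux_tilted:
  fixes P :: "('k::{alg_closed_field, field_char_0}, 'n::{finite, linorder}) ilaurent poly"
  assumes "Polynomial.lead_coeff P = 1" "puiseux_denominator (Polynomial.degree P) dvd e"
    and "coeffs_in (supported (tilted_lattice N e)) P"
  shows "splits_tilted P"
  using assms
proof (induction "Polynomial.degree P" arbitrary: P N e rule: less_induct)
  case less
  define m where "m = Polynomial.degree P"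
  interpret M: exponent_monoid "tilted_lattice N e :: (int, 'n) vec set" "\<lambda>a. nat (\<Sum>l\<in>UNIV. tilt N a l)"
    by (rule exponent_monoid_tilted_lattice)
  show ?case
  proof (cases m)
    case 0
    then have "P = linear_product []" using less.prems(1) by (auto simp: m_def elim!: degree_eq_zeroE)
    then show ?thesis unfolding splits_tilted_def by (metis empty_subsetI list.set(1))
  next
    case (Suc k)
    define c where "c = laurent_monom (- inverse (of_nat m)) 0 * Polynomial.coeff P k"
    have mc: "of_nat m * c = - Polynomial.coeff P k"
      by (rule ilaurent_eqI) (simp add: c_def ilaurent_coeff_of_nat_mult uminus_ilaurent.rep_eq Suc del: of_nat_Suc)
    have c: "c \<in> supported (tilted_lattice N e)"
      unfolding c_def using less.prems(3) M.zero_mem by (intro M.supported_times supported_laurent_monom) auto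
    define Q where "Q = pcompose P [:c, 1:]"
    have degQ: "Polynomial.degree Q = m" by (simp add: Q_def degree_pcompose m_def)
    have Q_monic: "Polynomial.lead_coeff Q = 1"
      unfolding Q_def using less.prems(1) by (subst lead_coeff_comp) auto
    have Q_depressed: "Polynomial.coeff Q (m - 1) = 0"
      using coeff_pcompose_shift[OF less.prems(1), of k c] mc Suc by (simp add: Q_def m_def del: of_nat_Suc)
    have Q_in: "coeffs_in (supported (tilted_lattice N e)) Q"
      unfolding Q_def using less.prems(3) c M.supported_1
      by (intro M.coeffs_in_pcompose) (auto simp: coeff_pCons split: nat.split)
    obtain e' where e': "e = fact m * e'" "puiseux_denominator k dvd e'"
    proof -
      have "fact m * puiseux_denominator k dvd e"
        using puiseux_denominator_dvd[of k m] less.prems(2) Suc unfolding m_def[symmetric] by (metis dvd_trans lessI)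
      then obtain u where "e = fact m * puiseux_denominator k * u" by (elim dvdE)
      then show thesis using that[of "puiseux_denominator k * u"] by (simp add: mult.assoc)
    qed
    have IH: "splits_tilted p" if "Polynomial.degree p < m" "Polynomial.lead_coeff p = 1"
      "coeffs_in (supported (tilted_lattice N' e')) p" for p :: "('k, 'n) ilaurent poly" and N'
    proof (rule less.hyps)
      have "puiseux_denominator (Polynomial.degree p) dvd puiseux_denominator k"
        unfolding puiseux_denominator_def using that(1) Suc by (intro prod_dvd_prod_subset) auto
      then show "puiseux_denominator (Polynomial.degree p) dvd e'" using e'(2) dvd_trans by blast
    qed (use that m_def in auto)
    have "splits_tilted Q"
      by (rule splits_tilted_depressed[OF Q_monic degQ _ Q_depressed Q_in[unfolded e'(1)] IH])
         (use Suc in simp)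
    moreover have "c \<in> supported (tilted_orthant N)"
      using c supported_mono[OF tilted_lattice_subset] by blast
    ultimately show ?thesis unfolding Q_def by (rule splits_tilted_shift)
  qed
qed

section \<open>Tilted orthants are S-cones\<close>

definition tilted_cone :: "nat \<Rightarrow> (real, 'n::{finite, linorder}) vec set" where
  "tilted_cone N = {v. \<forall>l. 0 \<le> tilt N v l}"

lemma blowup_funpow:
  assumes "j \<noteq> l"
  shows "(blowup j l ^^ N) v = (\<chi> i. if i = l then v $ l + real N * v $ j else v $ i)"
  using assms by (induction N) (auto simp: blowup_def vec_eq_iff algebra_simps)

lemma fold_blowup_column:
  assumes "l \<notin> set js" "distinct js"
  shows "fold (\<lambda>(i, j). blowup i j) (concat (map (\<lambda>j. replicate N (j, l)) js)) v =
    (\<chi> i. if i = l then v $ l + real N * (\<Sum>j\<in>set js. v $ j) else v $ i)"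
  using assms
proof (induction js arbitrary: v)
  case (Cons j js)
  have "(\<Sum>i\<in>set js. (\<chi> i. if i = l then v $ l + real N * v $ j else v $ i) $ i) = (\<Sum>i\<in>set js. v $ i)"
    using Cons.prems by (intro sum.cong) auto
  then show ?case
    using Cons by (auto simp: blowup_funpow vec_eq_iff algebra_simps)
qed (simp add: vec_eq_iff)

text \<open>
  The initial segments \<open>ls\<close> of the variables are the intermediate states of the sequence of
  blowing-ups: the coordinates in \<open>ls\<close> are finished, the others are still untouched.
\<close>

lemma fold_blowup_tilt:
  assumes "sorted_wrt (<) ls" "\<And>l j. l \<in> set ls \<Longrightarrow> j < l \<Longrightarrow> j \<in> set ls"
  shows "fold (\<lambda>(i, j). blowup i j)
      (concat (map (\<lambda>l. concat (map (\<lambda>j. replicate N (j, l)) (filter (\<lambda>j. j < l) vars))) ls)) v =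
    (\<chi> i. if i \<in> set ls then tilt N v i else v $ i)"
  using assms
proof (induction ls rule: rev_induct)
  case (snoc l ls)
  have below: "j \<in> set ls" if "j < l" for j
    using snoc.prems(2)[of l j] that by auto
  have closed: "j \<in> set ls" if "l' \<in> set ls" "j < l'" for l' j
    using snoc.prems(1) snoc.prems(2)[of l' j] that by (auto simp: sorted_wrt_append)
  have notin: "l \<notin> set ls" using snoc.prems(1) by (auto simp: sorted_wrt_append)
  have "(\<Sum>j\<in>{..<l}. (\<chi> i. if i \<in> set ls then tilt N v i else v $ i) $ j) = (\<Sum>j\<in>{..<l}. tilt N v j)"
    using below by (intro sum.cong) auto
  moreover have "sorted_wrt (<) ls" using snoc.prems(1) by (simp add: sorted_wrt_append)
  moreover have "{j. j < l} = {..<l}" by auto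
  ultimately show ?case
    using snoc.IH closed notin
    by (simp add: fold_blowup_column vec_eq_iff tilt.simps[of N v l])
qed (simp add: vec_eq_iff)

lemma standard_simplex_eq_convex_hull:
  "{y :: (real, 'n::finite) vec. (\<forall>l. 0 \<le> y $ l) \<and> (\<Sum>l\<in>UNIV. y $ l) = 1} =
    convex hull (range (\<lambda>l. axis l 1))" (is "?S = ?H")
proof
  show "?S \<subseteq> ?H"
  proof
    fix y :: "(real, 'n) vec" assume y: "y \<in> ?S"
    have "(\<Sum>l\<in>UNIV. y $ l *\<^sub>R (axis l 1 :: (real, 'n) vec)) \<in> ?H"
      using y by (intro convex_sum) (auto intro: hull_inc)
    moreover have "(\<Sum>l\<in>UNIV. y $ l *\<^sub>R (axis l 1 :: (real, 'n) vec)) = y"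
      using basis_expansion[of y] by (simp add: scalar_mult_eq_scaleR)
    ultimately show "y \<in> ?H" by simp
  qed
  have "convex ?S"
    by (auto simp: convex_def sum.distrib sum_distrib_left[symmetric])
  moreover have "range (\<lambda>l. axis l 1) \<subseteq> ?S" by (auto simp: axis_def)
  ultimately show "?H \<subseteq> ?S" by (intro hull_minimal)
qed

text \<open>
  The tilting is a linear automorphism \<open>L\<close> of \<open>\<real>^n\<close>, and its inverse carries the standard simplex to
  a base of the cone. The hyperplane of that base is where the tilted coordinates sum to \<open>1\<close>.
\<close>

lemma polyhedral_tilted_cone: "polyhedral_cone (tilted_cone N :: (real, 'n::{finite, linorder}) vec set)"
proof -
  define L where "L v = (\<chi> l. tilt N v l)" for v :: "(real, 'n) vec"
  have L: "L v $ l = tilt N v l" for v l by (simp add: L_def)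
  have tilt_scaleR: "tilt N (c *\<^sub>R v) l = c * tilt N v l" for c and v :: "(real, 'n) vec" and l
    using tilt_smult[of N c v l] by (simp add: scalar_mult_eq_scaleR)
  have lin: "linear L"
    by (rule linearI) (auto simp: vec_eq_iff L tilt_add tilt_scaleR)
  have "inj L"
    unfolding linear_injective_0[OF lin] using tilt_eq_0_imp[of N] by (auto simp: vec_eq_iff L)
  then obtain K where K: "linear K" "\<And>v. K (L v) = v" "\<And>y. L (K y) = y"
    using linear_injective_isomorphism[OF lin] by blast
  define u where "u = adjoint L (\<chi> l. 1)"
  have u: "u \<bullet> v = (\<Sum>l\<in>UNIV. tilt N v l)" for v
  proof -
    have "u \<bullet> v = L v \<bullet> (\<chi> l. 1)" unfolding u_def using adjoint_works[OF lin] by (simp add: inner_commute)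
    then show ?thesis by (simp add: inner_vec_def L)
  qed
  define \<Delta> where "\<Delta> = {v :: (real, 'n) vec. (\<forall>l. 0 \<le> tilt N v l) \<and> (\<Sum>l\<in>UNIV. tilt N v l) = 1}"
  have "\<Delta> = K ` {y. (\<forall>l. 0 \<le> y $ l) \<and> (\<Sum>l\<in>UNIV. y $ l) = 1}" (is "_ = K ` ?S")
  proof
    have "v \<in> K ` ?S" if "v \<in> \<Delta>" for v
      using that K(2)[of v] by (intro image_eqI[of _ _ "L v"]) (auto simp: \<Delta>_def L)
    then show "\<Delta> \<subseteq> K ` ?S" by blast
    show "K ` ?S \<subseteq> \<Delta>" using K(3) by (auto simp: \<Delta>_def L[symmetric])
  qed
  moreover have "polytope (convex hull (range (\<lambda>l. axis l 1)) :: (real, 'n) vec set)"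
    by (rule polytope_convex_hull) simp
  ultimately have "polytope \<Delta>"
    unfolding standard_simplex_eq_convex_hull using polytope_linear_image[OF K(1)] by simp
  define c where "c = K (\<chi> l. 1 / real CARD('n))"
  have c: "tilt N c l = 1 / real CARD('n)" for l unfolding L[symmetric] c_def K(3) by simp
  have c_in: "u \<bullet> c = 1" by (simp add: u c)
  have "top_of_set {v. u \<bullet> v = 1} interior_of \<Delta> \<noteq> {}"
  proof -
    let ?U = "{v. u \<bullet> v = 1} \<inter> (\<Inter>l. {v. 0 < L v $ l})"
    have "continuous_on UNIV L"
      using lin by (simp add: linear_continuous_on linear_conv_bounded_linear)
    then have "open {v. 0 < L v $ l}" for l
      by (intro open_Collect_less continuous_on_const continuous_on_component)
    then have "openin (top_of_set {v. u \<bullet> v = 1}) ?U" by (intro openin_open_Int open_INT) auto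
    moreover have "?U \<subseteq> \<Delta>" by (auto simp: \<Delta>_def u L intro: less_imp_le)
    ultimately have "?U \<subseteq> top_of_set {v. u \<bullet> v = 1} interior_of \<Delta>" by (intro interior_of_maximal)
    moreover have "c \<in> ?U" using c_in by (simp add: L c)
    ultimately show ?thesis by blast
  qed
  moreover have "tilted_cone N = cone_over \<Delta>"
  proof
    show "cone_over \<Delta> \<subseteq> tilted_cone N"
      by (auto simp: cone_over_def tilted_cone_def \<Delta>_def tilt_scaleR)
    show "tilted_cone N \<subseteq> cone_over \<Delta>"
    proof
      fix v :: "(real, 'n) vec" assume v: "v \<in> tilted_cone N"
      define s where "s = (\<Sum>l\<in>UNIV. tilt N v l)"
      have nonneg: "0 \<le> tilt N v l" for l using v by (simp add: tilted_cone_def)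
      then have "0 \<le> s" unfolding s_def by (simp add: sum_nonneg)
      show "v \<in> cone_over \<Delta>"
      proof (cases "s = 0")
        case True
        then have "tilt N v l = 0" for l
          using nonneg unfolding s_def by (simp add: sum_nonneg_eq_0_iff)
        then have "v = 0 *\<^sub>R c" using tilt_eq_0_imp[of N v] by simp
        moreover have "c \<in> \<Delta>" by (simp add: \<Delta>_def c)
        ultimately show ?thesis unfolding cone_over_def by blast
      next
        case False
        then have "inverse s *\<^sub>R v \<in> \<Delta>"
          using nonneg \<open>0 \<le> s\<close> by (simp add: \<Delta>_def tilt_scaleR sum_distrib_left[symmetric] s_def[symmetric])
        moreover have "v = s *\<^sub>R (inverse s *\<^sub>R v)" using False by simp
        ultimately show ?thesis unfolding cone_over_def using \<open>0 \<le> s\<close> by blast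
      qed
    qed
  qed
  moreover have "u \<noteq> 0" using c_in by auto
  moreover have "\<Delta> \<subseteq> {v. u \<bullet> v = 1}" by (auto simp: \<Delta>_def u)
  moreover note polytope_imp_compact[OF \<open>polytope \<Delta>\<close>] polytope_imp_polyhedron[OF \<open>polytope \<Delta>\<close>]
  ultimately show ?thesis unfolding polyhedral_cone_def
    by (intro exI[of _ \<Delta>] exI[of _ u] exI[of _ 1] conjI) simp_all
qed

lemma S_cone_tilted_cone: "S_cone (tilted_cone N :: (real, 'n::{finite, linorder}) vec set)"
  unfolding S_cone_def
proof (intro conjI exI)
  let ?bs = "concat (map (\<lambda>l. concat (map (\<lambda>j. replicate N (j, l)) (filter (\<lambda>j. j < l) vars))) vars) :: ('n \<times> 'n) list"
  show "\<forall>(i, j)\<in>set ?bs. i < j" by auto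
  show "fold (\<lambda>(i, j). blowup i j) ?bs ` tilted_cone N \<subseteq> {v. \<forall>l. 0 \<le> v $ l}"
    by (auto simp: fold_blowup_tilt tilted_cone_def)
qed (rule polyhedral_tilted_cone)

lemma newton_diagram_subset_tilted_cone:
  assumes "f \<in> supported (tilted_orthant N)"
  shows "newton_diagram d f \<subseteq> tilted_cone N"
proof
  fix v assume "v \<in> newton_diagram d f"
  then obtain a where a: "v = (\<chi> i. real_of_int (a $ i) / real d)" "ilaurent_coeff f a \<noteq> 0"
    by (auto simp: newton_diagram_def)
  then have "a \<in> tilted_orthant N" using assms by (auto simp: supported_def)
  moreover have "v = (1 / real d) *s (\<chi> i. real_of_int (a $ i))" by (simp add: a vec_eq_iff)
  ultimately show "v \<in> tilted_cone N"
    by (simp add: tilted_cone_def tilted_orthant_def tilt_smult tilt_of_int)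
qed

section \<open>Roots of polynomials over power series\<close>

lemma of_mfps_supported:
  fixes f :: "('a::zero, 'n::{finite, linorder}) mfps"
  shows "of_mfps d f \<in> supported (tilted_lattice 0 d)"
proof -
  have "scale_exp d b \<in> tilted_lattice 0 d" for b :: "(nat, 'n) vec"
    by (simp add: tilted_lattice_def tilted_orthant_def scale_exp_def)
  moreover have "a \<in> range (scale_exp d)" if "ilaurent_coeff (of_mfps d f) a \<noteq> 0" for a
    using of_mfps_coeff_eq_0 that by blast
  ultimately show ?thesis unfolding supported_def by blast
qed

lemma linear_product_nth: "linear_product zs = (\<Prod>i=1..length zs. [:- (zs ! (i - 1)), 1:])"
  by (simp add: linear_product_def prod.list_conv_set_nth prod.atLeast1_atMost_eq atLeast0LessThan)

theorem theorem1:
  fixes w :: "nat \<Rightarrow> ('k::{alg_closed_field, field_char_0}, 'n::{finite, linorder}) mfps"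
    and m :: nat
    and P :: "('k, 'n) mfps poly"
  assumes "CARD('n) > 1"
    and "m > 1"
    and "P = Polynomial.monom 1 m + (\<Sum>i=1..m. Polynomial.monom (w i) (m - i))"
    and "w m \<noteq> 0"
    and "rsquarefree (map_poly (\<lambda>c. to_ac (Fraction_Field.Fract c 1)) P)"
  shows "\<exists>d>0. \<exists>\<Gamma> :: ((real, 'n) vec) set. S_cone \<Gamma> \<and>
           (\<exists>\<zeta> :: nat \<Rightarrow> ('k, 'n) ilaurent.
              map_poly (of_mfps d) P = (\<Prod>i=1..m. [:- \<zeta> i, 1:]) \<and>
              (\<forall>i\<in>{1..m}. newton_diagram d (\<zeta> i) \<subseteq> \<Gamma>))"
proof -
  define d where "d = puiseux_denominator m"
  have d: "0 < d" by (simp add: d_def puiseux_denominator_def prod_pos)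
  have coeff_P: "Polynomial.coeff P j = (if j = m then 1 else if j < m then w (m - j) else 0)" for j
  proof -
    have "(\<Sum>i=1..m. if m - i = j then w i else 0) = (\<Sum>i\<in>{1..m} \<inter> {i. m - i = j}. w i)"
      by (simp add: sum.inter_restrict)
    also have "{1..m} \<inter> {i. m - i = j} = (if j < m then {m - j} else {})" by auto
    finally show ?thesis unfolding assms(3) by (simp add: Polynomial.coeff_sum)
  qed
  define F where "F = map_poly (of_mfps d) P"
  have coeff_F: "Polynomial.coeff F j = of_mfps d (Polynomial.coeff P j)" for j
    by (simp add: F_def coeff_map_poly)
  have "Polynomial.degree F = m"
  proof (rule antisym)
    show "Polynomial.degree F \<le> m" by (rule degree_le) (simp add: coeff_F coeff_P)
    show "m \<le> Polynomial.degree F" using d by (intro le_degree) (simp add: coeff_F coeff_P)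
  qed
  moreover from this have "Polynomial.lead_coeff F = 1" using d by (simp add: coeff_F coeff_P)
  moreover have "coeffs_in (supported (tilted_lattice 0 d)) F"
    by (simp add: coeff_F of_mfps_supported)
  ultimately have "splits_tilted F"
    by (intro newton_puiseux_tilted) (auto simp: d_def)
  then obtain N zs where zs: "F = linear_product zs" "set zs \<subseteq> supported (tilted_orthant N)"
    unfolding splits_tilted_def by blast
  have "length zs = m"
    using degree_linear_product[of zs] zs(1) \<open>Polynomial.degree F = m\<close> by simp
  then have "map_poly (of_mfps d) P = (\<Prod>i=1..m. [:- (zs ! (i - 1)), 1:])"
    using zs(1) linear_product_nth[of zs] by (simp add: F_def)
  moreover have "newton_diagram d (zs ! (i - 1)) \<subseteq> tilted_cone N" if "i \<in> {1..m}" for i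
  proof (rule newton_diagram_subset_tilted_cone)
    have "zs ! (i - 1) \<in> set zs" using that \<open>length zs = m\<close> by (intro nth_mem) auto
    then show "zs ! (i - 1) \<in> supported (tilted_orthant N)" using zs(2) by blast
  qed
  ultimately show ?thesis
    by (intro exI[of _ d] exI[of _ "tilted_cone N"] exI[of _ "\<lambda>i. zs ! (i - 1)"] conjI ballI d S_cone_tilted_cone)
qed

end
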